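(* Let $J$ be one of $\mathbb Z$, $\mathbb Z_+=\{n\in\mathbb Z:n\ge0\}$, $\mathbb Z_-=\{n\in\mathbb Z:n\le0\}$, let $\mathbf a=(a_n)_{n\in J}\subset(0,\infty)$ be an increasing sequence satisfying $a_{n+1}\ge2a_n$ for $n\in J$ if $J=\mathbb Z$ or $J=\mathbb Z_+$, and $a_n\ge2a_{n-1}$ for $n\in J$ if $J=\mathbb Z_-$, and let $\mathcal T_{\mathbf a}=(T_{\mathbf a}(t))_{t\ge0}$ be the associated Packel-type semigroup on $L^2(\mathbb R_+)\oplus L^2(\mathbb R_+)$ described in the context. Then: (i) for $t>0$, $T_{\mathbf a}(t)$ is similar to a contraction if and only if $J=\mathbb Z_-$; (ii) $\mathcal T_{\mathbf a}$ is similar to a quasi-contraction semigroup if and only if $J=\mathbb Z_+$.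
   Context: Construction. For $t>0$: if there is $n\in J$ with $a_n<t\le a_{n+1}$, set $n_0(t)=n$; otherwise, if $J=\mathbb Z_-$ and $t>a_0$ set $n_0(t)=0$, and if $J=\mathbb Z_+$ and $t\le a_0$ set $n_0(t)=-1$ with the convention $a_{-1}=0$. For $n\in J$ with $n>n_0(t)$ put $I_n(t)=(a_n-t,a_n]$, and put $I_{n_0(t)}(t)=[0,2a_{n_0(t)}-t]$. Define $V_{\mathbf a}(t)\in\mathcal L(L^2(\mathbb R_+))$ by $(V_{\mathbf a}(t)f)(x)=f(2a_n-x-t)$ if $x\in I_n(t)$ for some $n\ge n_0(t)$ (with $n\in J$ or $n=n_0(t)$), and $(V_{\mathbf a}(t)f)(x)=0$ otherwise; $V_{\mathbf a}(0)=0$. Let $R(t)$ and $L(t)$ be the right and left shifts on $L^2(\mathbb R_+)$: $(R(t)f)(x)=f(x-t)\chi_{[0,\infty)}(x-t)$, $(L(t)f)(x)=f(x+t)$. Set $T_{\mathbf a}(t)=\begin{pmatrix}L(t)&V_{\mathbf a}(t)\\0&R(t)\end{pmatrix}$ on $L^2(\mathbb R_+)\oplus L^2(\mathbb R_+)$; this is a bounded $C_0$-semigroup. An operator $T$ is similar to a contraction if $\|STS^{-1}\|\le1$ for some bounded invertible $S$; a $C_0$-semigroup $(T(t))$ is similar to a quasi-contraction semigroup if there are a bounded invertible $S$ and $\lambda\in\mathbb R$ with $\|ST(t)S^{-1}\|\le e^{\lambda t}$ for all $t\ge0$. *)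

theory Defs
  imports "HOL-Analysis.Analysis"
begin

section \<open>L^2(R_+) as square-integrable functions (modulo null functions via the seminorm)\<close>

type_synonym fn = "real \<Rightarrow> complex"
type_synonym hvec = "fn \<times> fn"

definition L2plus :: "fn set" where
  "L2plus = {f. set_borel_measurable lborel {0..} f \<and>
                set_integrable lborel {0..} (\<lambda>x. (cmod (f x))\<^sup>2)}"

definition l2sq :: "fn \<Rightarrow> real" where
  "l2sq f = set_lebesgue_integral lborel {0..} (\<lambda>x. (cmod (f x))\<^sup>2)"

definition Hsp :: "hvec set" where
  "Hsp = L2plus \<times> L2plus"

definition hnorm :: "hvec \<Rightarrow> real" where
  "hnorm u = sqrt (l2sq (fst u) + l2sq (snd u))"

definition hlin :: "complex \<Rightarrow> hvec \<Rightarrow> hvec \<Rightarrow> hvec" where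
  "hlin c u v = ((\<lambda>x. c * fst u x + fst v x), (\<lambda>x. c * snd u x + snd v x))"

definition hdiff :: "hvec \<Rightarrow> hvec \<Rightarrow> hvec" where
  "hdiff u v = ((\<lambda>x. fst u x - fst v x), (\<lambda>x. snd u x - snd v x))"

text \<open>Bounded (complex-)linear operators on L^2(R_+) \<oplus> L^2(R_+); equalities are up to null
  elements, i.e. in the quotient L^2.\<close>
definition bounded_op :: "(hvec \<Rightarrow> hvec) \<Rightarrow> bool" where
  "bounded_op A \<longleftrightarrow>
     (\<forall>u\<in>Hsp. A u \<in> Hsp) \<and>
     (\<forall>c u v. u \<in> Hsp \<longrightarrow> v \<in> Hsp \<longrightarrow> hnorm (hdiff (A (hlin c u v)) (hlin c (A u) (A v))) = 0) \<and>
     (\<forall>u v. u \<in> Hsp \<longrightarrow> v \<in> Hsp \<longrightarrow> hnorm (hdiff u v) = 0 \<longrightarrow> hnorm (hdiff (A u) (A v)) = 0) \<and>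
     (\<exists>C. \<forall>u\<in>Hsp. hnorm (A u) \<le> C * hnorm u)"

definition inverse_ops :: "(hvec \<Rightarrow> hvec) \<Rightarrow> (hvec \<Rightarrow> hvec) \<Rightarrow> bool" where
  "inverse_ops S S' \<longleftrightarrow> bounded_op S \<and> bounded_op S' \<and>
     (\<forall>u\<in>Hsp. hnorm (hdiff (S (S' u)) u) = 0 \<and> hnorm (hdiff (S' (S u)) u) = 0)"

definition similar_to_contraction :: "(hvec \<Rightarrow> hvec) \<Rightarrow> bool" where
  "similar_to_contraction T \<longleftrightarrow>
     (\<exists>S S'. inverse_ops S S' \<and> (\<forall>u\<in>Hsp. hnorm (S (T (S' u))) \<le> hnorm u))"

definition similar_to_quasicontraction :: "(real \<Rightarrow> hvec \<Rightarrow> hvec) \<Rightarrow> bool" where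
  "similar_to_quasicontraction T \<longleftrightarrow>
     (\<exists>S S' (w::real). inverse_ops S S' \<and>
        (\<forall>t\<ge>0. \<forall>u\<in>Hsp. hnorm (S (T t (S' u))) \<le> exp (w * t) * hnorm u))"

text \<open>a extended by the convention a_{-1} = 0 (used only when J = Z_+).\<close>
definition aext :: "int set \<Rightarrow> (int \<Rightarrow> real) \<Rightarrow> int \<Rightarrow> real" where
  "aext J a n = (if n \<in> J then a n else 0)"

definition n0 :: "int set \<Rightarrow> (int \<Rightarrow> real) \<Rightarrow> real \<Rightarrow> int" where
  "n0 J a t =
     (if \<exists>n. n \<in> J \<and> n + 1 \<in> J \<and> a n < t \<and> t \<le> a (n + 1)
      then (SOME n. n \<in> J \<and> n + 1 \<in> J \<and> a n < t \<and> t \<le> a (n + 1))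
      else if J = {..0} \<and> t > a 0 then 0
      else if J = {0..} \<and> t \<le> a 0 then -1
      else undefined)"

definition Iint :: "int set \<Rightarrow> (int \<Rightarrow> real) \<Rightarrow> real \<Rightarrow> int \<Rightarrow> real set" where
  "Iint J a t n =
     (if n = n0 J a t then {0 .. 2 * aext J a n - t}
      else if n \<in> J \<and> n > n0 J a t then {a n - t <.. a n}
      else {})"

definition Vop :: "int set \<Rightarrow> (int \<Rightarrow> real) \<Rightarrow> real \<Rightarrow> fn \<Rightarrow> fn" where
  "Vop J a t f x =
     (if t > 0 \<and> (\<exists>n. x \<in> Iint J a t n)
      then (let n = (SOME n. x \<in> Iint J a t n) in f (2 * aext J a n - x - t))
      else 0)"

definition Lsh :: "real \<Rightarrow> fn \<Rightarrow> fn" where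
  "Lsh t f x = f (x + t)"

definition Rsh :: "real \<Rightarrow> fn \<Rightarrow> fn" where
  "Rsh t f x = (if x - t \<ge> 0 then f (x - t) else 0)"

definition Ta :: "int set \<Rightarrow> (int \<Rightarrow> real) \<Rightarrow> real \<Rightarrow> hvec \<Rightarrow> hvec" where
  "Ta J a t u = ((\<lambda>x. Lsh t (fst u) x + Vop J a t (snd u) x), Rsh t (snd u))"

end

(*
A value g(y) carried by the second component travels to the right, and when it passes a_n it leaves
in the first component a copy that travels to the left. So the semigroup is L + R perturbed by
reflections, and formally V = L X - X R, where X f (x) = sum_n f(2 a_n - x) on (a_n, 2 a_n].

If J = Z_-, only finitely many n matter for a fixed t > 0; the truncated X is bounded, and the shear
(f, g) -> (f + X g, g) conjugates T(t) to the contraction L(t) + R(t). If J = Z_+, consecutive a_n have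
distance at least a_0, and multiplication by suitable weights that jump at the a_n makes the semigroup
quasi-contractive.

If a_n is unbounded (for a single t), or if a_n tends to 0 (for the whole semigroup), take g supported
in a short interval at 0 and let it evolve to times slightly below 2 a_n, for M different n. The
reflected parts at these times nearly coincide and leave through 0 soon afterwards; the transmitted
parts are pairwise orthogonal. In an equivalent Hilbert norm in which T(t) is a (quasi-)contraction,
the losses of energy along the orbit have a bounded sum. The average of the M states hence loses
energy of order 1/M only, although it is within O(M^(-1/2)) of its reflected part, which is lost
completely.
*)
theory Submission
  imports Defs "HOL-Library.Function_Algebras"
begin

section \<open>The space L^2(R_+) + L^2(R_+)\<close>

text \<open>Elements of \<open>L2plus\<close> are arbitrary on the negative axis. This
  representative vanishes there, so translations and reflections can be substituted in integrals
  over the whole line.\<close>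

definition cut :: "fn \<Rightarrow> fn" where
  "cut f = (\<lambda>x. indicator {0..} x *\<^sub>R f x)"

lemma cut_nonneg [simp]: "0 \<le> x \<Longrightarrow> cut f x = f x"
  by (simp add: cut_def)

lemma cut_neg [simp]: "x < 0 \<Longrightarrow> cut f x = 0"
  by (simp add: cut_def)

lemma cut_add: "cut (f + g) x = cut f x + cut g x"
  by (simp add: cut_def scaleR_add_right)

lemma cut_diff: "cut (f - g) x = cut f x - cut g x"
  by (simp add: cut_def scaleR_diff_right)

text \<open>The squared norm with values in \<open>ennreal\<close>. A Bochner integral is 0 by
  convention when the integrand is not integrable, so \<open>l2sq\<close> alone cannot detect
  membership in \<open>L2plus\<close>; one bound on \<open>nn2\<close> yields both membership and
  the bound on \<open>l2sq\<close>.\<close>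

definition nn2 :: "fn \<Rightarrow> ennreal" where
  "nn2 f = (\<integral>\<^sup>+x. ennreal ((cmod (cut f x))\<^sup>2) \<partial>lborel)"

lemma indicator_cut_sq: "indicator {0..} x *\<^sub>R (cmod (f x))\<^sup>2 = (cmod (cut f x))\<^sup>2"
  by (simp add: indicator_def cut_def)

lemma L2plus_iff: "f \<in> L2plus \<longleftrightarrow> cut f \<in> borel_measurable borel \<and> nn2 f < \<infinity>"
proof -
  have "f \<in> L2plus \<longleftrightarrow> cut f \<in> borel_measurable borel \<and> integrable lborel (\<lambda>x. (cmod (cut f x))\<^sup>2)"
    unfolding L2plus_def set_borel_measurable_def set_integrable_def indicator_cut_sq
    by (simp add: cut_def)
  moreover have "integrable lborel (\<lambda>x. (cmod (cut f x))\<^sup>2) \<longleftrightarrow> nn2 f < \<infinity>"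
    if [measurable]: "cut f \<in> borel_measurable borel"
    by (simp add: integrable_iff_bounded nn2_def)
  ultimately show ?thesis by blast
qed

lemma L2plus_measurable [measurable_dest]: "f \<in> L2plus \<Longrightarrow> cut f \<in> borel_measurable borel"
  by (simp add: L2plus_iff)

lemma l2sq_eq: "l2sq f = (LINT x|lborel. (cmod (cut f x))\<^sup>2)"
  unfolding l2sq_def set_lebesgue_integral_def indicator_cut_sq ..

lemma l2sq_nonneg [simp]: "0 \<le> l2sq f"
  unfolding l2sq_eq by simp

lemma L2plus_integrable: "f \<in> L2plus \<Longrightarrow> integrable lborel (\<lambda>x. (cmod (cut f x))\<^sup>2)"
  unfolding L2plus_def set_integrable_def indicator_cut_sq by simp

lemma nn2_eq: "f \<in> L2plus \<Longrightarrow> nn2 f = ennreal (l2sq f)"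
  unfolding nn2_def l2sq_eq by (rule nn_integral_eq_integral[OF L2plus_integrable]) auto

lemma l2sq_leI: "nn2 f \<le> ennreal c \<Longrightarrow> 0 \<le> c \<Longrightarrow> l2sq f \<le> c"
proof (cases "integrable lborel (\<lambda>x. (cmod (cut f x))\<^sup>2)")
  case True
  assume "nn2 f \<le> ennreal c" "0 \<le> c"
  with True show ?thesis
    unfolding nn2_def l2sq_eq by (subst (asm) nn_integral_eq_integral) auto
qed (simp add: l2sq_eq not_integrable_integral_eq)

lemma L2plusI:
  assumes "cut f \<in> borel_measurable borel" "nn2 f \<le> ennreal c"
  shows "f \<in> L2plus"
  using assms by (auto simp: L2plus_iff order.strict_trans1 ennreal_less_top)

lemma cmod_add_sq_le: "(cmod (x + y))\<^sup>2 \<le> 2 * (cmod x)\<^sup>2 + 2 * (cmod y)\<^sup>2"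
proof -
  have "(cmod (x + y))\<^sup>2 \<le> (cmod x + cmod y)\<^sup>2"
    by (simp add: norm_triangle_ineq power_mono)
  also have "\<dots> \<le> 2 * (cmod x)\<^sup>2 + 2 * (cmod y)\<^sup>2"
    using sum_squares_bound[of "cmod x" "cmod y"] by (simp add: power2_sum)
  finally show ?thesis .
qed

lemma nn2_add_le:
  assumes [measurable]: "cut f \<in> borel_measurable borel" "cut g \<in> borel_measurable borel"
  shows "nn2 (f + g) \<le> 2 * nn2 f + 2 * nn2 g"
proof -
  have "nn2 (f + g) \<le> (\<integral>\<^sup>+x. 2 * ennreal ((cmod (cut f x))\<^sup>2) + 2 * ennreal ((cmod (cut g x))\<^sup>2) \<partial>lborel)"
    unfolding nn2_def
  proof (rule nn_integral_mono)
    fix x :: real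
    have "ennreal ((cmod (cut (f + g) x))\<^sup>2) \<le> ennreal (2 * (cmod (cut f x))\<^sup>2 + 2 * (cmod (cut g x))\<^sup>2)"
      using cmod_add_sq_le[of "cut f x" "cut g x"] by (intro ennreal_leI) (simp add: cut_add)
    also have "\<dots> = 2 * ennreal ((cmod (cut f x))\<^sup>2) + 2 * ennreal ((cmod (cut g x))\<^sup>2)"
      by (simp add: ennreal_plus ennreal_mult)
    finally show "ennreal ((cmod (cut (f + g) x))\<^sup>2)
      \<le> 2 * ennreal ((cmod (cut f x))\<^sup>2) + 2 * ennreal ((cmod (cut g x))\<^sup>2)" .
  qed
  also have "\<dots> = 2 * nn2 f + 2 * nn2 g"
    by (simp add: nn_integral_add nn_integral_cmult nn2_def)
  finally show ?thesis .
qed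

lemma L2plus_add:
  assumes "f \<in> L2plus" "g \<in> L2plus"
  shows "f + g \<in> L2plus" and "l2sq (f + g) \<le> 2 * l2sq f + 2 * l2sq g"
proof -
  have [measurable]: "cut f \<in> borel_measurable borel" "cut g \<in> borel_measurable borel"
    using assms by (auto simp: L2plus_iff)
  have "(\<lambda>x. cut f x + cut g x) \<in> borel_measurable borel"
    by measurable
  moreover have "(\<lambda>x. cut f x + cut g x) = cut (f + g)"
    by (auto simp: cut_add)
  ultimately have m: "cut (f + g) \<in> borel_measurable borel"
    by simp
  have le: "nn2 (f + g) \<le> ennreal (2 * l2sq f + 2 * l2sq g)"
    using nn2_add_le[of f g] assms by (simp add: nn2_eq ennreal_plus ennreal_mult)
  show "f + g \<in> L2plus" by (rule L2plusI[OF m le])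
  show "l2sq (f + g) \<le> 2 * l2sq f + 2 * l2sq g" by (rule l2sq_leI[OF le]) simp
qed

lemma L2plus_bounded_mult:
  assumes f: "f \<in> L2plus" and [measurable]: "p \<in> borel_measurable borel"
    and p: "\<And>x. 0 \<le> x \<Longrightarrow> cmod (p x) \<le> c"
  shows "(\<lambda>x. p x * f x) \<in> L2plus" and "l2sq (\<lambda>x. p x * f x) \<le> c\<^sup>2 * l2sq f"
proof -
  have [measurable]: "cut f \<in> borel_measurable borel" using f by (simp add: L2plus_iff)
  have "(\<lambda>x. p x * cut f x) \<in> borel_measurable borel" by measurable
  moreover have "(\<lambda>x. p x * cut f x) = cut (\<lambda>x. p x * f x)" by (auto simp: cut_def)
  ultimately have m: "cut (\<lambda>x. p x * f x) \<in> borel_measurable borel" by simp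
  have "nn2 (\<lambda>x. p x * f x) \<le> (\<integral>\<^sup>+x. ennreal (c\<^sup>2) * ennreal ((cmod (cut f x))\<^sup>2) \<partial>lborel)"
    unfolding nn2_def
  proof (rule nn_integral_mono)
    fix x :: real
    have "(cmod (p x))\<^sup>2 \<le> c\<^sup>2" if "0 \<le> x"
      using p[OF that] by (simp add: power_mono)
    then have "(cmod (cut (\<lambda>x. p x * f x) x))\<^sup>2 \<le> c\<^sup>2 * (cmod (cut f x))\<^sup>2"
      by (auto simp: cut_def indicator_def norm_mult power_mult_distrib mult_right_mono)
    then show "ennreal ((cmod (cut (\<lambda>x. p x * f x) x))\<^sup>2) \<le> ennreal (c\<^sup>2) * ennreal ((cmod (cut f x))\<^sup>2)"
      by (simp add: ennreal_mult[symmetric] ennreal_leI)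
  qed
  also have "\<dots> = ennreal (c\<^sup>2 * l2sq f)"
    using f by (simp add: nn_integral_cmult nn2_def[symmetric] nn2_eq ennreal_mult)
  finally have le: "nn2 (\<lambda>x. p x * f x) \<le> ennreal (c\<^sup>2 * l2sq f)" .
  show "(\<lambda>x. p x * f x) \<in> L2plus" by (rule L2plusI[OF m le])
  show "l2sq (\<lambda>x. p x * f x) \<le> c\<^sup>2 * l2sq f" by (rule l2sq_leI[OF le]) simp
qed

lemma L2plus_cmult:
  assumes "f \<in> L2plus"
  shows "(\<lambda>x. c * f x) \<in> L2plus"
  using L2plus_bounded_mult(1)[of f "\<lambda>_. c" "cmod c"] assms by simp

lemma L2plus_diff:
  assumes "f \<in> L2plus" "g \<in> L2plus"
  shows "f - g \<in> L2plus"
proof -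
  have "f + (\<lambda>x. (-1) * g x) \<in> L2plus"
    using assms by (intro L2plus_add L2plus_cmult)
  then show ?thesis by (simp add: fun_diff_def plus_fun_def)
qed

lemma L2plus_zero: "0 \<in> L2plus"
  by (simp add: L2plus_iff nn2_def zero_fun_def cut_def)

lemma l2sq_parallelogram:
  assumes "f \<in> L2plus" "g \<in> L2plus"
  shows "l2sq (f + g) + l2sq (f - g) = 2 * l2sq f + 2 * l2sq g"
proof -
  have *: "(cmod (cut (f + g) x))\<^sup>2 + (cmod (cut (f - g) x))\<^sup>2 = 2 * (cmod (cut f x))\<^sup>2 + 2 * (cmod (cut g x))\<^sup>2" for x
    by (simp add: cut_add cut_diff power2_norm_eq_inner inner_add inner_diff inner_commute)
  have "l2sq (f + g) + l2sq (f - g) = (LINT x|lborel. (cmod (cut (f + g) x))\<^sup>2 + (cmod (cut (f - g) x))\<^sup>2)"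
    unfolding l2sq_eq using assms
    by (intro Bochner_Integration.integral_add[symmetric] L2plus_integrable L2plus_add L2plus_diff)
  also have "\<dots> = (LINT x|lborel. 2 * (cmod (cut f x))\<^sup>2 + 2 * (cmod (cut g x))\<^sup>2)"
    unfolding * ..
  also have "\<dots> = 2 * l2sq f + 2 * l2sq g"
    unfolding l2sq_eq using assms
    by (subst Bochner_Integration.integral_add) (auto intro: L2plus_integrable)
  finally show ?thesis .
qed

section \<open>The direct sum: vector operations, parallelogram law, null vectors, bounded
  operators\<close>

lemma hdiff_eq: "hdiff u v = u - v"
  by (simp add: hdiff_def minus_prod_def fun_diff_def)

lemma hlin_add: "hlin 1 u v = u + v"
  by (simp add: hlin_def plus_prod_def plus_fun_def)

lemma hnorm_sq: "(hnorm u)\<^sup>2 = l2sq (fst u) + l2sq (snd u)"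
  by (simp add: hnorm_def)

lemma hnorm_nonneg [simp]: "0 \<le> hnorm u"
  by (simp add: hnorm_def)

lemma hnorm_zero [simp]: "hnorm 0 = 0"
  by (simp add: hnorm_def l2sq_eq zero_prod_def cut_def)

lemma hnorm_hdiff_self [simp]: "hnorm (hdiff u u) = 0"
  by (simp add: hdiff_eq)

lemma Hsp_add: "u \<in> Hsp \<Longrightarrow> v \<in> Hsp \<Longrightarrow> u + v \<in> Hsp"
  by (auto simp: Hsp_def intro: L2plus_add)

lemma Hsp_diff: "u \<in> Hsp \<Longrightarrow> v \<in> Hsp \<Longrightarrow> u - v \<in> Hsp"
  by (auto simp: Hsp_def intro: L2plus_diff)

lemma Hsp_zero: "0 \<in> Hsp"
  by (auto simp: Hsp_def zero_prod_def intro: L2plus_zero)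

lemma Hsp_sum: "(\<And>i. i \<in> A \<Longrightarrow> u i \<in> Hsp) \<Longrightarrow> sum u A \<in> Hsp"
  by (induction A rule: infinite_finite_induct) (auto intro: Hsp_add Hsp_zero)

lemma hlin_Hsp: "u \<in> Hsp \<Longrightarrow> v \<in> Hsp \<Longrightarrow> hlin c u v \<in> Hsp"
  using L2plus_add(1)[OF L2plus_cmult[of "fst u" c], of "fst v"]
    L2plus_add(1)[OF L2plus_cmult[of "snd u" c], of "snd v"]
  by (auto simp: Hsp_def hlin_def plus_fun_def)

lemma hnorm_parallelogram:
  assumes "u \<in> Hsp" "v \<in> Hsp"
  shows "(hnorm (u + v))\<^sup>2 + (hnorm (u - v))\<^sup>2 = 2 * (hnorm u)\<^sup>2 + 2 * (hnorm v)\<^sup>2"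
  using l2sq_parallelogram[of "fst u" "fst v"] l2sq_parallelogram[of "snd u" "snd v"] assms
  by (auto simp: hnorm_sq Hsp_def)

lemma l2sq_null_diff:
  assumes f: "f \<in> L2plus" and g: "g \<in> L2plus" and "l2sq (f - g) = 0"
  shows "l2sq f = l2sq g"
proof -
  have d: "f - g \<in> L2plus" using f g by (rule L2plus_diff)
  then have "AE x in lborel. (cmod (cut (f - g) x))\<^sup>2 = 0"
    using assms(3) L2plus_integrable[OF d] unfolding l2sq_eq
    by (subst (asm) integral_nonneg_eq_0_iff_AE) auto
  then have "AE x in lborel. (cmod (cut f x))\<^sup>2 = (cmod (cut g x))\<^sup>2"
    by eventually_elim (auto simp: cut_diff)
  then show ?thesis
    unfolding l2sq_eq using f g by (intro integral_cong_AE) (auto dest!: L2plus_measurable)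
qed

lemma hnorm_null_diff:
  assumes "u \<in> Hsp" "v \<in> Hsp" "hnorm (hdiff u v) = 0"
  shows "hnorm u = hnorm v"
proof -
  have "l2sq (fst u - fst v) + l2sq (snd u - snd v) = 0"
    using assms(3) hnorm_sq[of "hdiff u v"] by (simp add: hdiff_eq)
  then have "l2sq (fst u - fst v) = 0" "l2sq (snd u - snd v) = 0"
    using l2sq_nonneg[of "fst u - fst v"] l2sq_nonneg[of "snd u - snd v"] by linarith+
  then have "l2sq (fst u) = l2sq (fst v)" "l2sq (snd u) = l2sq (snd v)"
    using assms(1,2) by (auto simp: Hsp_def intro: l2sq_null_diff)
  then show ?thesis by (simp add: hnorm_def)
qed

lemma hnorm_cong:
  assumes "\<And>x. 0 \<le> x \<Longrightarrow> fst u x = fst v x \<and> snd u x = snd v x"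
  shows "hnorm u = hnorm v"
proof -
  have "cut (fst u) = cut (fst v)" "cut (snd u) = cut (snd v)"
    using assms by (auto simp: cut_def indicator_def fun_eq_iff)
  then show ?thesis unfolding hnorm_def l2sq_eq by simp
qed

text \<open>For maps that are exactly linear on functions, compatibility with null differences
  follows from the bound, applied to \<open>hdiff u v\<close>.\<close>

lemma bounded_op_linearI:
  assumes H: "\<And>u. u \<in> Hsp \<Longrightarrow> A u \<in> Hsp"
    and lin: "\<And>c u v. A (hlin c u v) = hlin c (A u) (A v)"
    and bd: "\<And>u. u \<in> Hsp \<Longrightarrow> (hnorm (A u))\<^sup>2 \<le> C * (hnorm u)\<^sup>2"
  shows "bounded_op A"
  unfolding bounded_op_def
proof (intro conjI allI ballI impI exI)
  show *: "hnorm (A u) \<le> sqrt C * hnorm u" if "u \<in> Hsp" for u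
    using real_sqrt_le_mono[OF bd[OF that]] by (simp add: real_sqrt_mult)
  show "hnorm (hdiff (A (hlin c u v)) (hlin c (A u) (A v))) = 0" for c u v
    by (simp add: lin)
  show "hnorm (hdiff (A u) (A v)) = 0" if uv: "u \<in> Hsp" "v \<in> Hsp" and n: "hnorm (hdiff u v) = 0" for u v
  proof -
    have eq: "hdiff p q = hlin (-1) q p" for p q
      by (simp add: hdiff_def hlin_def)
    have "hnorm (A (hdiff u v)) \<le> sqrt C * hnorm (hdiff u v)"
      using uv by (intro *) (simp add: eq hlin_Hsp)
    then have "hnorm (A (hdiff u v)) = 0"
      using n hnorm_nonneg[of "A (hdiff u v)"] by simp
    then show ?thesis by (simp only: eq lin)
  qed
qed (use H in auto)

lemma
  assumes "bounded_op S"
  shows bounded_op_Hsp: "\<And>u. u \<in> Hsp \<Longrightarrow> S u \<in> Hsp"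
    and bounded_op_hlin: "\<And>c u v. u \<in> Hsp \<Longrightarrow> v \<in> Hsp \<Longrightarrow> hnorm (hdiff (S (hlin c u v)) (hlin c (S u) (S v))) = 0"
    and bounded_op_null: "\<And>u v. u \<in> Hsp \<Longrightarrow> v \<in> Hsp \<Longrightarrow> hnorm (hdiff u v) = 0 \<Longrightarrow> hnorm (hdiff (S u) (S v)) = 0"
    and bounded_op_bound: "\<exists>C. \<forall>u\<in>Hsp. hnorm (S u) \<le> C * hnorm u"
  using assms unfolding bounded_op_def by blast+

text \<open>\<open>S\<close> is linear only up to null vectors. Later arguments see it only through
  the quadratic form \<open>(hnorm (S u))\<^sup>2\<close>, for which equality of norms is
  enough.\<close>

lemma bounded_op_hnorm:
  assumes S: "bounded_op S" and u: "u \<in> Hsp" and v: "v \<in> Hsp"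
  shows "hnorm (S (u + v)) = hnorm (S u + S v)" and "hnorm (S (u - v)) = hnorm (S u - S v)"
    and "hnorm (hdiff u v) = 0 \<Longrightarrow> hnorm (S u) = hnorm (S v)"
proof -
  note H = bounded_op_Hsp[OF S] and lin = bounded_op_hlin[OF S]
  have m: "hlin (-1) w z = z - w" for w z
    by (simp add: hlin_def minus_prod_def fun_eq_iff)
  show "hnorm (S (u + v)) = hnorm (S u + S v)"
    using lin[OF u v, of 1] u v by (intro hnorm_null_diff) (auto simp: hlin_add intro: H Hsp_add)
  show "hnorm (S (u - v)) = hnorm (S u - S v)"
    using lin[OF v u, of "-1"] u v by (intro hnorm_null_diff) (auto simp: m intro: H Hsp_diff)
  assume "hnorm (hdiff u v) = 0"
  then have "hnorm (hdiff (S u) (S v)) = 0" using bounded_op_null[OF S u v] by simp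
  then show "hnorm (S u) = hnorm (S v)" using u v by (intro hnorm_null_diff H)
qed

section \<open>The two shifts\<close>

lemma cut_Rsh: "0 \<le> t \<Longrightarrow> cut (Rsh t f) x = cut f (x - t)"
  by (auto simp: Rsh_def cut_def indicator_def)

lemma L2plus_Rsh:
  assumes f: "f \<in> L2plus" and t: "0 \<le> t"
  shows "Rsh t f \<in> L2plus" and "l2sq (Rsh t f) \<le> l2sq f"
proof -
  have [measurable]: "cut f \<in> borel_measurable borel" using f by (simp add: L2plus_iff)
  have eq: "cut (Rsh t f) = (\<lambda>x. cut f (x - t))" using t by (auto simp: cut_Rsh)
  have m: "cut (Rsh t f) \<in> borel_measurable borel" unfolding eq by measurable
  have "nn2 f = nn2 (Rsh t f)"
    using nn_integral_real_affine[of "\<lambda>x. ennreal ((cmod (cut f x))\<^sup>2)" 1 "-t"]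
    by (simp add: nn2_def eq)
  then have le: "nn2 (Rsh t f) \<le> ennreal (l2sq f)" using f by (simp add: nn2_eq)
  show "Rsh t f \<in> L2plus" by (rule L2plusI[OF m le])
  show "l2sq (Rsh t f) \<le> l2sq f" by (rule l2sq_leI[OF le]) simp
qed

lemma L2plus_Lsh:
  assumes f: "f \<in> L2plus" and t: "0 \<le> t"
  shows "Lsh t f \<in> L2plus" and "l2sq (Lsh t f) \<le> l2sq f"
proof -
  have [measurable]: "cut f \<in> borel_measurable borel" using f by (simp add: L2plus_iff)
  have eq: "cut (Lsh t f) = (\<lambda>x. indicator {0..} x *\<^sub>R cut f (x + t))"
    using t by (auto simp: cut_def indicator_def Lsh_def)
  have m: "cut (Lsh t f) \<in> borel_measurable borel" unfolding eq by measurable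
  have "nn2 (Lsh t f) \<le> (\<integral>\<^sup>+x. ennreal ((cmod (cut f (x + t)))\<^sup>2) \<partial>lborel)"
    unfolding nn2_def eq by (intro nn_integral_mono ennreal_leI) (auto simp: indicator_def)
  also have "\<dots> = nn2 f"
    using nn_integral_real_affine[of "\<lambda>x. ennreal ((cmod (cut f x))\<^sup>2)" 1 t]
    by (simp add: nn2_def add.commute)
  finally have le: "nn2 (Lsh t f) \<le> ennreal (l2sq f)" using f by (simp add: nn2_eq)
  show "Lsh t f \<in> L2plus" by (rule L2plusI[OF m le])
  show "l2sq (Lsh t f) \<le> l2sq f" by (rule l2sq_leI[OF le]) simp
qed

section \<open>Reflection at the points of a doubling sequence\<close>

text \<open>One condition for the three index sets and both growth hypotheses: doubling between
  neighbours together with monotonicity gives doubling for any two indices n < m.\<close>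

locale doubling =
  fixes J :: "int set" and a :: "int \<Rightarrow> real"
  assumes J: "J = UNIV \<or> J = {0..} \<or> J = {..0}"
    and pos: "n \<in> J \<Longrightarrow> 0 < a n"
    and gr: "n \<in> J \<Longrightarrow> m \<in> J \<Longrightarrow> n < m \<Longrightarrow> 2 * a n \<le> a m"
begin

lemma J_between: "l \<in> J \<Longrightarrow> u \<in> J \<Longrightarrow> l \<le> n \<Longrightarrow> n \<le> u \<Longrightarrow> n \<in> J"
  using J by auto

lemma a_mono: "n \<in> J \<Longrightarrow> m \<in> J \<Longrightarrow> n \<le> m \<Longrightarrow> a n \<le> a m"
  using gr[of n m] pos[of n] by (cases "n = m") auto

text \<open>Here \<open>J\<close> contains every nonpositive integer, and each step down at least
  halves the value.\<close>

lemma a_small: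
  assumes "J \<noteq> {0..}" "0 < e"
  shows "\<exists>n\<in>J. n \<le> 0 \<and> a n < e"
proof -
  have mem: "- int k \<in> J" for k using J assms(1) by auto
  have "a (- int k) * 2 ^ k \<le> a 0" for k
  proof (induction k)
    case (Suc k)
    have "a (- int (Suc k)) * 2 ^ Suc k \<le> a (- int k) * 2 ^ k"
      using gr[OF mem[of "Suc k"] mem[of k]] by simp
    with Suc show ?case by linarith
  qed simp
  moreover obtain k where k: "a 0 / e < 2 ^ k"
    using real_arch_pow[of 2 "a 0 / e"] by auto
  ultimately have "a (- int k) * 2 ^ k < e * 2 ^ k"
    using assms(2) by (metis mult.commute order.strict_trans1 pos_divide_less_eq)
  then show ?thesis using mem[of k] by (intro bexI[of _ "- int k"]) auto
qed

lemma a_large: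
  assumes "J \<noteq> {..0}"
  shows "\<exists>n\<in>J. 0 \<le> n \<and> B < a n"
proof -
  have mem: "int k \<in> J" for k using J assms(1) by auto
  have "a 0 * 2 ^ k \<le> a (int k)" for k
  proof (induction k)
    case (Suc k)
    have "2 * a (int k) \<le> a (int (Suc k))"
      using gr[OF mem[of k] mem[of "Suc k"]] by simp
    with Suc show ?case by simp
  qed simp
  moreover obtain k where k: "B / a 0 < 2 ^ k"
    using real_arch_pow[of 2 "B / a 0"] by auto
  moreover have "0 < a 0" using pos mem[of 0] by simp
  ultimately have "B < a (int k)"
    by (metis mult.commute order.strict_trans2 pos_divide_less_eq)
  then show ?thesis using mem[of k] by (intro bexI[of _ "int k"]) auto
qed

text \<open>A discrete intermediate value argument: without a crossing, \<open>a n < t\<close> would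
  propagate from \<open>l\<close> up to \<open>u\<close>.\<close>

lemma crossing:
  assumes "l \<in> J" "u \<in> J" "a l < t" "t \<le> a u"
  shows "\<exists>n. n \<in> J \<and> n + 1 \<in> J \<and> a n < t \<and> t \<le> a (n + 1)"
proof (rule ccontr)
  assume *: "\<not> ?thesis"
  have lu: "l \<le> u" using assms a_mono[of u l] by (rule_tac ccontr) auto
  have "n \<le> u \<longrightarrow> a n < t" if "l \<le> n" for n
    using that
  proof (induction n rule: int_ge_induct)
    case (step i)
    show ?case
    proof
      assume "i + 1 \<le> u"
      moreover have "i \<in> J" "i + 1 \<in> J"
        using J_between[OF assms(1,2)] step(1) \<open>i + 1 \<le> u\<close> by auto
      ultimately show "a (i + 1) < t" using step * by fastforce
    qed
  qed (use assms in auto)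
  with lu assms(4) show False by fastforce
qed

text \<open>Replaces the choice in \<open>n0\<close> by order facts. For t > 0 the
  \<open>undefined\<close> branch is never reached: points on both sides of t force a crossing, and
  \<open>a_small\<close>, \<open>a_large\<close> supply such points where \<open>J\<close> is
  unbounded. The second case is \<open>J = {0..}\<close> with value -1.\<close>

lemma n0_cases:
  assumes "0 < t"
  obtains (inside) "n0 J a t \<in> J" "a (n0 J a t) < t" "\<And>n. n \<in> J \<Longrightarrow> n0 J a t < n \<Longrightarrow> t \<le> a n"
  | (below) "n0 J a t \<notin> J" "\<And>n. n \<in> J \<Longrightarrow> n0 J a t < n \<and> t \<le> a n"
proof -
  define P where "P n \<longleftrightarrow> n \<in> J \<and> n + 1 \<in> J \<and> a n < t \<and> t \<le> a (n + 1)" for n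
  have n0: "n0 J a t = (if \<exists>n. P n then (SOME n. P n) else if J = {..0} \<and> t > a 0 then 0
      else if J = {0..} \<and> t \<le> a 0 then -1 else undefined)"
    unfolding n0_def P_def ..
  consider "\<exists>n. P n" | "\<nexists>n. P n" "J = UNIV" | "\<nexists>n. P n" "J = {..0}" | "\<nexists>n. P n" "J = {0..}"
    using J by blast
  then show thesis
  proof cases
    case 1
    then have P: "P (n0 J a t)" unfolding n0 by (auto intro: someI_ex)
    show thesis
    proof (rule inside)
      show "t \<le> a n" if "n \<in> J" "n0 J a t < n" for n
        using P a_mono[of "n0 J a t + 1" n] that by (auto simp: P_def)
    qed (use P in \<open>auto simp: P_def\<close>)
  next
    case 2
    obtain l u where "l \<in> J" "u \<in> J" "a l < t" "t < a u"
      using a_small[of t] a_large[of t] 2 assms by auto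
    then show thesis using crossing[of l u t] 2(1) by (auto simp: P_def)
  next
    case 3
    have "a 0 < t"
    proof (rule ccontr)
      assume "\<not> a 0 < t"
      moreover obtain l where "l \<in> J" "a l < t"
        using a_small[of t] 3 assms by auto
      ultimately show False using crossing[of l 0 t] 3 by (auto simp: P_def)
    qed
    then have "n0 J a t = 0" unfolding n0 using 3 by auto
    then show thesis using 3 \<open>a 0 < t\<close> by (intro inside) auto
  next
    case 4
    have t: "t \<le> a 0"
    proof (rule ccontr)
      assume "\<not> t \<le> a 0"
      moreover obtain u where "u \<in> J" "t < a u"
        using a_large[of t] 4 by auto
      ultimately show False using crossing[of 0 u t] 4 by (auto simp: P_def)
    qed
    then have "n0 J a t = -1" unfolding n0 using 4 by auto
    then show thesis using 4 t a_mono[of 0] by (intro below) fastforce+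
  qed
qed

text \<open>Positions at time \<open>t\<close> of the left-moving particles that were created at \<open>a n\<close>.\<close>
definition E :: "real \<Rightarrow> int \<Rightarrow> real set" where
  "E t n = {x. n \<in> J \<and> 0 \<le> x \<and> x \<le> a n \<and> a n - t < x \<and> x \<le> 2 * a n - t}"

lemma E_measurable [measurable]: "E t n \<in> sets borel"
  unfolding E_def by measurable

text \<open>For n < m, doubling separates the sets: x <= 2 a_n - t <= a_m - t on the first, x > a_m
  - t on the second.\<close>

lemma E_unique:
  assumes "x \<in> E t n" "x \<in> E t m"
  shows "n = m"
proof -
  have False if "x \<in> E t n" "x \<in> E t m" "n < m" for n m
    using that gr[of n m] by (auto simp: E_def)
  then show ?thesis using assms by (metis linorder_neqE)
qed

text \<open>Above \<open>n0\<close> one has t <= a_n, so the bounds of \<open>E\<close> reduce to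
  (a_n - t, a_n]; at \<open>n0\<close>, a_n < t leaves [0, 2 a_n - t]; below \<open>n0\<close>, 2
  a_n < t makes the set empty. With the convention a_{-1} = 0 the interval [0, -t] is empty as
  well.\<close>

lemma Iint_iff:
  assumes t: "0 < t"
  shows "x \<in> Iint J a t n \<longleftrightarrow> x \<in> E t n"
  using t
proof (cases rule: n0_cases)
  case inside
  consider "n = n0 J a t" | "n0 J a t < n" | "n < n0 J a t" by linarith
  then show ?thesis
  proof cases
    case 1
    then show ?thesis using inside by (auto simp: Iint_def E_def aext_def)
  next
    case 2
    show ?thesis
    proof (cases "n \<in> J")
      case True
      then show ?thesis using 2 inside(3)[OF True 2] by (auto simp: Iint_def E_def)
    qed (use 2 in \<open>auto simp: Iint_def E_def\<close>)
  next
    case 3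
    then show ?thesis using inside gr[of n "n0 J a t"] by (auto simp: Iint_def E_def)
  qed
next
  case below
  show ?thesis
  proof (cases "n \<in> J")
    case True
    then show ?thesis using below(2)[OF True] by (auto simp: Iint_def E_def)
  qed (use below t in \<open>auto simp: Iint_def E_def aext_def\<close>)
qed

section \<open>Pointwise formula, measurability and norm bound of V(t)\<close>

lemma Vop_E:
  assumes "x \<in> E t n"
  shows "Vop J a t f x = f (2 * a n - x - t)"
proof -
  have t: "0 < t" and n: "n \<in> J" using assms by (auto simp: E_def)
  have "(SOME n. x \<in> Iint J a t n) = n"
    using assms by (auto simp: Iint_iff[OF t] intro: E_unique)
  then show ?thesis using assms t n
    by (auto simp: Vop_def Iint_iff[OF t] aext_def Let_def)
qed

lemma Vop_zero: "(\<And>n. x \<notin> E t n) \<Longrightarrow> Vop J a t f x = 0"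
  by (auto simp: Vop_def Iint_iff)

lemma Vop_neg: "x < 0 \<Longrightarrow> Vop J a t f x = 0"
  by (rule Vop_zero) (auto simp: E_def)

lemma cut_Vop: "cut (Vop J a t f) = Vop J a t f"
  by (rule ext) (metis cut_neg cut_nonneg Vop_neg not_less)

text \<open>By \<open>E_unique\<close> at most one term is nonzero, so any \<phi> fixing 0 passes
  through the series. The identity gives measurability, the weighted squared modulus gives the
  integral formula.\<close>

lemma Vop_suminf:
  fixes \<phi> :: "complex \<Rightarrow> 'b :: {t2_space, topological_comm_monoid_add}"
  assumes "\<phi> 0 = 0"
  shows "\<phi> (Vop J a t f x) = (\<Sum>k. if x \<in> E t (int_decode k)
    then \<phi> (cut f (2 * a (int_decode k) - x - t)) else 0)"
proof (cases "\<exists>n. x \<in> E t n")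
  case True
  then obtain n where n: "x \<in> E t n" by blast
  define k where "k = int_encode n"
  have "(\<Sum>i. if x \<in> E t (int_decode i) then \<phi> (cut f (2 * a (int_decode i) - x - t)) else 0)
    = (\<Sum>i\<in>{k}. if x \<in> E t (int_decode i) then \<phi> (cut f (2 * a (int_decode i) - x - t)) else 0)"
  proof (rule suminf_finite)
    show "(if x \<in> E t (int_decode i) then \<phi> (cut f (2 * a (int_decode i) - x - t)) else 0) = 0"
      if "i \<notin> {k}" for i
      using that E_unique[OF n, of "int_decode i"] by (auto simp: k_def)
  qed simp
  also have "\<dots> = \<phi> (Vop J a t f x)"
    using n by (simp add: k_def Vop_E) (simp add: E_def)
  finally show ?thesis ..
next
  case False
  then show ?thesis by (simp add: Vop_zero assms)
qed

lemma Vop_measurable: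
  assumes [measurable]: "cut f \<in> borel_measurable borel"
  shows "Vop J a t f \<in> borel_measurable borel"
proof -
  have "(\<lambda>x. \<Sum>k. if x \<in> E t (int_decode k) then cut f (2 * a (int_decode k) - x - t) else 0)
    \<in> borel_measurable borel"
    by measurable
  then show ?thesis using Vop_suminf[where \<phi> = "\<lambda>z. z"] by (simp cong: measurable_cong)
qed

lemma nn_integral_reflect:
  fixes G :: "real \<Rightarrow> ennreal"
  assumes "G \<in> borel_measurable borel"
  shows "(\<integral>\<^sup>+x. G x \<partial>lborel) = (\<integral>\<^sup>+y. G (c - y) \<partial>lborel)"
  using nn_integral_real_affine[of G "-1" c] assms by simp

text \<open>The point \<open>x = 0\<close> has to be left out for the reflected pieces to be disjoint: if
  \<open>a (n + 1) = 2 * a n\<close> they share an end point.\<close>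
lemma nn_integral_Vop:
  assumes [measurable]: "cut f \<in> borel_measurable borel" "F \<in> borel_measurable borel"
  shows "(\<integral>\<^sup>+x. F x * ennreal ((cmod (Vop J a t f x))\<^sup>2) \<partial>lborel)
    = (\<integral>\<^sup>+y. (\<Sum>k. indicator (E t (int_decode k) - {0}) (2 * a (int_decode k) - y - t)
          * F (2 * a (int_decode k) - y - t)) * ennreal ((cmod (cut f y))\<^sup>2) \<partial>lborel)"
proof -
  define c where "c k = 2 * a (int_decode k) - t" for k
  define G where "G k x = indicator (E t (int_decode k) - {0}) x * F x * ennreal ((cmod (cut f (c k - x)))\<^sup>2)" for k x
  have [measurable]: "G k \<in> borel_measurable borel" for k
    unfolding G_def by measurable
  \<comment> \<open>Each summand is reflected separately by y = c_k - x; afterwards |f(y)|^2 is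
    common to all summands and factors out.\<close>
  have "(\<integral>\<^sup>+x. F x * ennreal ((cmod (Vop J a t f x))\<^sup>2) \<partial>lborel) = (\<integral>\<^sup>+x. (\<Sum>k. G k x) \<partial>lborel)"
  proof (rule nn_integral_cong_AE)
    show "AE x in lborel. F x * ennreal ((cmod (Vop J a t f x))\<^sup>2) = (\<Sum>k. G k x)"
      using AE_lborel_singleton[of 0]
    proof eventually_elim
      case (elim x)
      have "F x * ennreal ((cmod (Vop J a t f x))\<^sup>2) = (\<Sum>k. if x \<in> E t (int_decode k)
          then F x * ennreal ((cmod (cut f (2 * a (int_decode k) - x - t)))\<^sup>2) else 0)"
        by (rule Vop_suminf) simp
      also have "\<dots> = (\<Sum>k. G k x)"
        using elim by (intro suminf_cong) (auto simp: G_def c_def algebra_simps)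
      finally show ?case .
    qed
  qed
  also have "\<dots> = (\<Sum>k. \<integral>\<^sup>+x. G k x \<partial>lborel)"
    by (rule nn_integral_suminf) simp
  also have "\<dots> = (\<Sum>k. \<integral>\<^sup>+y. G k (c k - y) \<partial>lborel)"
    by (intro suminf_cong nn_integral_reflect) simp
  also have "\<dots> = (\<integral>\<^sup>+y. (\<Sum>k. G k (c k - y)) \<partial>lborel)"
    by (rule nn_integral_suminf[symmetric]) simp
  also have "(\<lambda>y. \<Sum>k. G k (c k - y)) = (\<lambda>y. (\<Sum>k. indicator (E t (int_decode k) - {0}) (2 * a (int_decode k) - y - t)
          * F (2 * a (int_decode k) - y - t)) * ennreal ((cmod (cut f y))\<^sup>2))"
    by (simp add: G_def c_def ennreal_suminf_multc[symmetric] algebra_simps)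
  finally show ?thesis .
qed

text \<open>For n < m, a positive n-th position means y + t < 2 a_n, while the m-th position being
  at most a_m means a_m <= y + t; this contradicts 2 a_n <= a_m.\<close>

lemma reflected_unique:
  assumes "2 * a n - y - t \<in> E t n - {0}" "2 * a m - y - t \<in> E t m - {0}"
  shows "n = m"
proof -
  have False if "2 * a n - y - t \<in> E t n - {0}" "2 * a m - y - t \<in> E t m - {0}" "n < m" for n m
    using that gr[of n m] by (auto simp: E_def)
  then show ?thesis using assms by (metis linorder_neqE)
qed

text \<open>At most one term survives, so \<open>F\<close> has to be bounded only at the copy of a
  particle that started at y < a_n and has reached a_n by time t.\<close>

lemma reflected_sum_le:
  fixes F :: "real \<Rightarrow> ennreal"
  assumes "\<And>n. n \<in> J \<Longrightarrow> 0 < 2 * a n - y - t \<Longrightarrow> a n \<le> y + t \<Longrightarrow> y < a n \<Longrightarrow> 0 \<le> y \<Longrightarrow> F (2 * a n - y - t) \<le> B"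
  shows "(\<Sum>k. indicator (E t (int_decode k) - {0}) (2 * a (int_decode k) - y - t)
          * F (2 * a (int_decode k) - y - t)) \<le> B"
proof (cases "\<exists>n. 2 * a n - y - t \<in> E t n - {0}")
  case True
  then obtain n where n: "2 * a n - y - t \<in> E t n - {0}" by blast
  define k where "k = int_encode n"
  have "(\<Sum>k. indicator (E t (int_decode k) - {0}) (2 * a (int_decode k) - y - t) * F (2 * a (int_decode k) - y - t))
    = (\<Sum>k\<in>{k}. indicator (E t (int_decode k) - {0}) (2 * a (int_decode k) - y - t) * F (2 * a (int_decode k) - y - t))"
  proof (rule suminf_finite)
    show "indicator (E t (int_decode i) - {0}) (2 * a (int_decode i) - y - t) * F (2 * a (int_decode i) - y - t) = 0"
      if "i \<notin> {k}" for i
    proof -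
      have "2 * a (int_decode i) - y - t \<notin> E t (int_decode i) - {0}"
        using reflected_unique[OF n, of "int_decode i"] that unfolding k_def by force
      then show ?thesis by (subst indicator_simps(2)) simp_all
    qed
  qed simp
  also have "\<dots> = F (2 * a n - y - t)" using n by (simp add: k_def indicator_def)
  also have "\<dots> \<le> B" using n by (intro assms) (auto simp: E_def)
  finally show ?thesis .
next
  case False
  then have "(\<lambda>k. indicator (E t (int_decode k) - {0}) (2 * a (int_decode k) - y - t)
          * F (2 * a (int_decode k) - y - t)) = (\<lambda>k. 0)"
    by (auto simp: indicator_def)
  then show ?thesis by simp
qed

lemma nn2_Vop_le:
  assumes "cut f \<in> borel_measurable borel"
  shows "nn2 (Vop J a t f) \<le> nn2 f"
proof -
  have "nn2 (Vop J a t f) = (\<integral>\<^sup>+x. 1 * ennreal ((cmod (Vop J a t f x))\<^sup>2) \<partial>lborel)"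
    by (simp add: nn2_def cut_Vop)
  also have "\<dots> \<le> (\<integral>\<^sup>+y. 1 * ennreal ((cmod (cut f y))\<^sup>2) \<partial>lborel)"
    unfolding nn_integral_Vop[OF assms borel_measurable_const]
    by (intro nn_integral_mono mult_right_mono reflected_sum_le) auto
  finally show ?thesis by (simp add: nn2_def)
qed

lemma L2plus_Vop:
  assumes f: "f \<in> L2plus"
  shows "Vop J a t f \<in> L2plus" and "l2sq (Vop J a t f) \<le> l2sq f"
proof -
  have mf: "cut f \<in> borel_measurable borel" using f by (simp add: L2plus_iff)
  have m: "cut (Vop J a t f) \<in> borel_measurable borel"
    unfolding cut_Vop using Vop_measurable[OF mf] .
  have le: "nn2 (Vop J a t f) \<le> ennreal (l2sq f)" using nn2_Vop_le[OF mf] f by (simp add: nn2_eq)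
  show "Vop J a t f \<in> L2plus" by (rule L2plusI[OF m le])
  show "l2sq (Vop J a t f) \<le> l2sq f" by (rule l2sq_leI[OF le]) simp
qed

lemma Vop_linear: "Vop J a t (\<lambda>x. c * f x + g x) x = c * Vop J a t f x + Vop J a t g x"
  by (cases "\<exists>n. x \<in> E t n") (auto simp: Vop_E Vop_zero)

lemma Ta_linear: "Ta J a t (hlin c u v) = hlin c (Ta J a t u) (Ta J a t v)"
proof -
  have "Vop J a t (\<lambda>x. c * snd u x + snd v x) = (\<lambda>x. c * Vop J a t (snd u) x + Vop J a t (snd v) x)"
    by (rule ext) (rule Vop_linear)
  then show ?thesis
    by (simp add: Ta_def hlin_def Lsh_def Rsh_def fun_eq_iff) (simp add: algebra_simps)
qed

lemma Ta_eq: "Ta J a t u = (Lsh t (fst u) + Vop J a t (snd u), Rsh t (snd u))"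
  by (simp add: Ta_def plus_fun_def)

lemma Ta_Hsp: "u \<in> Hsp \<Longrightarrow> 0 \<le> t \<Longrightarrow> Ta J a t u \<in> Hsp"
  by (auto simp: Hsp_def Ta_eq intro!: L2plus_add L2plus_Vop L2plus_Lsh L2plus_Rsh)

lemma bounded_op_Ta:
  assumes t: "0 \<le> t"
  shows "bounded_op (Ta J a t)"
\<comment> \<open>The constant comes from 2|Lf|^2 + 2|Vg|^2 + |Rg|^2 <= 2|f|^2 + 3|g|^2.\<close>
proof (rule bounded_op_linearI[where C = 3])
  fix u assume u: "u \<in> Hsp"
  then have f: "fst u \<in> L2plus" and g: "snd u \<in> L2plus" by (auto simp: Hsp_def)
  show "(hnorm (Ta J a t u))\<^sup>2 \<le> 3 * (hnorm u)\<^sup>2"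
    using L2plus_add(2)[OF L2plus_Lsh(1)[OF f t] L2plus_Vop(1)[OF g, of t]]
      L2plus_Lsh(2)[OF f t] L2plus_Vop(2)[OF g, of t] L2plus_Rsh(2)[OF g t] l2sq_nonneg[of "fst u"]
    unfolding hnorm_sq Ta_eq fst_conv snd_conv by argo
qed (use t in \<open>auto simp: Ta_Hsp Ta_linear\<close>)

end

section \<open>The bounded intertwiner for finitely many reflections\<close>

text \<open>On \<open>A\<close> both x and c - x are nonnegative, so \<open>f\<close> may be
  replaced by \<open>cut f\<close> under the reflection.\<close>

lemma L2plus_reflect:
  assumes f: "f \<in> L2plus" and [measurable]: "A \<in> sets borel" and A: "A \<subseteq> {0..c}"
  shows "(\<lambda>x. indicator A x *\<^sub>R f (c - x)) \<in> L2plus"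
    and "l2sq (\<lambda>x. indicator A x *\<^sub>R f (c - x)) \<le> l2sq f"
proof -
  have [measurable]: "cut f \<in> borel_measurable borel" using f by (simp add: L2plus_iff)
  have eq: "cut (\<lambda>x. indicator A x *\<^sub>R f (c - x)) = (\<lambda>x. indicator A x *\<^sub>R cut f (c - x))"
    using A by (auto simp: cut_def indicator_def fun_eq_iff)
  have m: "cut (\<lambda>x. indicator A x *\<^sub>R f (c - x)) \<in> borel_measurable borel"
    unfolding eq by measurable
  have "nn2 (\<lambda>x. indicator A x *\<^sub>R f (c - x)) \<le> (\<integral>\<^sup>+x. ennreal ((cmod (cut f (c - x)))\<^sup>2) \<partial>lborel)"
    unfolding nn2_def eq by (intro nn_integral_mono ennreal_leI) (auto simp: indicator_def)
  also have "\<dots> = nn2 f"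
    using nn_integral_real_affine[of "\<lambda>x. ennreal ((cmod (cut f x))\<^sup>2)" "-1" c]
    by (simp add: nn2_def)
  finally have le: "nn2 (\<lambda>x. indicator A x *\<^sub>R f (c - x)) \<le> ennreal (l2sq f)"
    using f by (simp add: nn2_eq)
  show "(\<lambda>x. indicator A x *\<^sub>R f (c - x)) \<in> L2plus" by (rule L2plusI[OF m le])
  show "l2sq (\<lambda>x. indicator A x *\<^sub>R f (c - x)) \<le> l2sq f" by (rule l2sq_leI[OF le]) simp
qed

text \<open>The block matrix with identity diagonal and \<open>X\<close> in the upper corner; the
  shear by -X is its inverse. Conjugation with it serves to cancel the off-diagonal entry
  V(t).\<close>

definition shear :: "(fn \<Rightarrow> fn) \<Rightarrow> hvec \<Rightarrow> hvec" where
  "shear X u = (fst u + X (snd u), snd u)"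

lemma bounded_op_shear:
  assumes lin: "\<And>c f g. X (\<lambda>x. c * f x + g x) = (\<lambda>x. c * X f x + X g x)"
    and L2: "\<And>f. f \<in> L2plus \<Longrightarrow> X f \<in> L2plus"
    and bd: "\<And>f. f \<in> L2plus \<Longrightarrow> l2sq (X f) \<le> C * l2sq f" and C: "0 \<le> C"
  shows "bounded_op (shear X)"
proof (rule bounded_op_linearI)
  show "shear X u \<in> Hsp" if "u \<in> Hsp" for u
    using that L2plus_add(1)[OF _ L2] by (simp add: Hsp_def shear_def mem_Times_iff)
  show "shear X (hlin c u v) = hlin c (shear X u) (shear X v)" for c u v
    unfolding shear_def hlin_def fst_conv snd_conv lin by (simp add: fun_eq_iff distrib_left)
  show "(hnorm (shear X u))\<^sup>2 \<le> (2 + 2 * C + 1) * (hnorm u)\<^sup>2" if "u \<in> Hsp" for u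
  proof -
    have f: "fst u \<in> L2plus" and g: "snd u \<in> L2plus" using that by (auto simp: Hsp_def)
    have "(hnorm (shear X u))\<^sup>2 \<le> 2 * l2sq (fst u) + 2 * (C * l2sq (snd u)) + l2sq (snd u)"
      using L2plus_add(2)[OF f L2[OF g]] bd[OF g] by (simp add: hnorm_sq shear_def)
    also have "\<dots> \<le> (2 + 2 * C + 1) * (hnorm u)\<^sup>2"
      using C by (simp add: hnorm_sq algebra_simps)
    finally show ?thesis .
  qed
qed

context doubling
begin

text \<open>A right mover at y < a_n and a left mover at 2 a_n - y reach a_n simultaneously, so the
  future reflection can be booked in advance as a left mover at 2 a_n - y. The targets (a_n, 2 a_n]
  are disjoint but the sources [0, a_n) are nested, hence the restriction to finite
  \<open>F\<close>.\<close>

definition X :: "int set \<Rightarrow> fn \<Rightarrow> fn" where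
  "X F f x = (\<Sum>n\<in>F. indicator {a n<..2 * a n} x *\<^sub>R f (2 * a n - x))"

lemma X_linear: "X F (\<lambda>x. c * f x + g x) = (\<lambda>x. c * X F f x + X F g x)"
  by (simp add: X_def fun_eq_iff scaleR_add_right sum.distrib sum_distrib_left)

lemma X_bounded:
  assumes "finite F" "F \<subseteq> J"
  shows "\<exists>C\<ge>0. \<forall>f\<in>L2plus. X F f \<in> L2plus \<and> l2sq (X F f) \<le> C * l2sq f"
  using assms
proof (induction F)
  case empty
  have X: "X {} f = 0" for f by (rule ext) (simp add: X_def)
  have l2: "l2sq 0 = 0" by (simp add: l2sq_eq cut_def)
  show ?case unfolding X l2 using L2plus_zero by (intro exI[of _ 0]) (simp add: zero_fun_def)
next
  case (insert n F)
  then obtain C where C: "C \<ge> 0" "\<And>f. f \<in> L2plus \<Longrightarrow> X F f \<in> L2plus"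
    "\<And>f. f \<in> L2plus \<Longrightarrow> l2sq (X F f) \<le> C * l2sq f" by auto
  define p where "p f = (\<lambda>x. indicator {a n<..2 * a n} x *\<^sub>R f (2 * a n - x) :: complex)" for f
  have "0 < a n" using insert.prems pos by auto
  then have p: "p f \<in> L2plus" "l2sq (p f) \<le> l2sq f" if "f \<in> L2plus" for f
    unfolding p_def by (intro L2plus_reflect[OF that]; auto)+
  have X: "X (insert n F) f = p f + X F f" for f
    unfolding fun_eq_iff plus_fun_apply X_def p_def by (intro allI sum.insert insert.hyps)
  show ?case
  proof (intro exI[of _ "2 + 2 * C"] conjI ballI)
    fix f assume f: "f \<in> L2plus"
    show "X (insert n F) f \<in> L2plus" unfolding X using f C p by (intro L2plus_add) auto
    have "l2sq (p f + X F f) \<le> 2 * l2sq (p f) + 2 * l2sq (X F f)"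
      using f C p by (intro L2plus_add) auto
    also have "\<dots> \<le> (2 + 2 * C) * l2sq f"
      using C(3)[OF f] p(2)[OF f] by (simp add: algebra_simps)
    finally show "l2sq (X (insert n F) f) \<le> (2 + 2 * C) * l2sq f" unfolding X .
  qed (use C in simp)
qed

text \<open>On \<open>x \<ge> 0\<close> this reads \<open>L X - X R = V\<close>.\<close>
lemma X_intertwine:
  assumes "0 < t" "0 \<le> x" "finite F" "F \<subseteq> J" "{n \<in> J. t \<le> 2 * a n} \<subseteq> F"
  shows "X F g (x + t) = Vop J a t g x + X F (Rsh t g) x"
proof -
  \<comment> \<open>If x <= a_n, the booked particle has crossed a_n during time t and is counted by
    V(t); if x > a_n, it is still booked, now for the shifted g.\<close>
  have "indicator {a n<..2 * a n} (x + t) *\<^sub>R g (2 * a n - (x + t))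
      = (if x \<in> E t n then g (2 * a n - x - t) else 0)
        + indicator {a n<..2 * a n} x *\<^sub>R Rsh t g (2 * a n - x)" if "n \<in> F" for n
    using that assms by (auto simp: E_def Rsh_def indicator_def algebra_simps)
  then have "X F g (x + t) = (\<Sum>n\<in>F. if x \<in> E t n then g (2 * a n - x - t) else 0) + X F (Rsh t g) x"
    by (simp add: X_def sum.distrib)
  moreover have "(\<Sum>n\<in>F. if x \<in> E t n then g (2 * a n - x - t) else 0) = Vop J a t g x"
  proof (cases "\<exists>n. x \<in> E t n")
    case True
    then obtain n where n: "x \<in> E t n" by blast
    \<comment> \<open>A nonempty \<open>E t n\<close> requires 0 <= 2 a_n - t, and \<open>F\<close>
      contains all such n.\<close>
    then have "n \<in> F" using assms by (auto simp: E_def)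
    have "(\<Sum>m\<in>F. if x \<in> E t m then g (2 * a m - x - t) else 0)
        = (\<Sum>m\<in>F. if m = n then g (2 * a m - x - t) else 0)"
      using n E_unique by (intro sum.cong) auto
    then show ?thesis using n \<open>n \<in> F\<close> assms by (simp add: Vop_E)
  qed (simp add: Vop_zero)
  ultimately show ?thesis by simp
qed

lemma similar_to_contraction_Ta:
  assumes JE: "J = {..0}" and t: "0 < t"
  shows "similar_to_contraction (Ta J a t)"
proof -
  \<comment> \<open>The indices whose reflections are visible at time t. They are bounded above by 0
    and below because a_n tends to 0 as n decreases.\<close>
  define F where "F = {n \<in> J. t \<le> 2 * a n}"
  obtain m where m: "m \<in> J" "a m < t / 2" using a_small[of "t / 2"] JE t by auto
  have "F \<subseteq> {m..0}"
  proof
    fix n assume "n \<in> F"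
    then show "n \<in> {m..0}" using m a_mono[of n m] JE by (cases "m \<le> n") (auto simp: F_def)
  qed
  then have F: "finite F" "F \<subseteq> J" by (auto intro: finite_subset simp: F_def)
  obtain C where C: "C \<ge> 0" "\<And>f. f \<in> L2plus \<Longrightarrow> X F f \<in> L2plus"
    "\<And>f. f \<in> L2plus \<Longrightarrow> l2sq (X F f) \<le> C * l2sq f" using X_bounded[OF F] by auto
  define Y where "Y f = (\<lambda>x. - X F f x)" for f
  have Y: "Y f = 0 - X F f" for f by (simp add: Y_def fun_eq_iff)
  have YL2: "Y f \<in> L2plus" if "f \<in> L2plus" for f
    unfolding Y using that C by (intro L2plus_diff L2plus_zero)
  have Ysq: "l2sq (Y f) = l2sq (X F f)" for f by (simp add: Y_def l2sq_def)
  have S': "bounded_op (shear Y)"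
  proof (rule bounded_op_shear[OF _ YL2 _ C(1)])
    show "Y (\<lambda>x. c * f x + g x) = (\<lambda>x. c * Y f x + Y g x)" for c f g
      by (simp add: Y_def X_linear)
    show "l2sq (Y f) \<le> C * l2sq f" if "f \<in> L2plus" for f
      using C(3)[OF that] by (simp only: Ysq)
  qed
  have S: "bounded_op (shear (X F))"
    by (rule bounded_op_shear[OF X_linear C(2,3,1)])
  have "shear (X F) (shear Y u) = u" "shear Y (shear (X F) u) = u" for u
    by (simp_all add: shear_def Y_def fun_eq_iff prod_eq_iff)
  then have inv: "inverse_ops (shear (X F)) (shear Y)"
    using S S' by (simp add: inverse_ops_def)
  have "hnorm (shear (X F) (Ta J a t (shear Y u))) \<le> hnorm u" if "u \<in> Hsp" for u
  proof -
    have f: "fst u \<in> L2plus" and g: "snd u \<in> L2plus" using that by (auto simp: Hsp_def)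
    \<comment> \<open>The first component is L(f - Xg) + Vg + XRg, which is Lf by the intertwining
      relation; this holds for x >= 0, which is all that \<open>hnorm\<close> sees.\<close>
    have "hnorm (shear (X F) (Ta J a t (shear Y u))) = hnorm (Lsh t (fst u), Rsh t (snd u))"
      using X_intertwine[OF t _ F] by (intro hnorm_cong) (simp add: shear_def Ta_def Y_def Lsh_def F_def)
    also have "\<dots> \<le> hnorm u"
      using L2plus_Lsh(2)[OF f, of t] L2plus_Rsh(2)[OF g, of t] t
      by (simp add: hnorm_def)
    finally show ?thesis .
  qed
  with inv show ?thesis unfolding similar_to_contraction_def by blast
qed

end

section \<open>Weights for a sequence with gaps\<close>

definition mulop :: "(real \<Rightarrow> real) \<Rightarrow> (real \<Rightarrow> real) \<Rightarrow> hvec \<Rightarrow> hvec" where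
  "mulop p q u = ((\<lambda>x. complex_of_real (p x) * fst u x), (\<lambda>x. complex_of_real (q x) * snd u x))"

lemma bounded_op_mulop:
  assumes [measurable]: "p \<in> borel_measurable borel" "q \<in> borel_measurable borel"
    and bd: "\<And>x. \<bar>p x\<bar> \<le> c" "\<And>x. \<bar>q x\<bar> \<le> c"
  shows "bounded_op (mulop p q)"
proof (rule bounded_op_linearI)
  have p: "(\<lambda>x. complex_of_real (p x) * f x) \<in> L2plus" "l2sq (\<lambda>x. complex_of_real (p x) * f x) \<le> c\<^sup>2 * l2sq f"
    and q: "(\<lambda>x. complex_of_real (q x) * f x) \<in> L2plus" "l2sq (\<lambda>x. complex_of_real (q x) * f x) \<le> c\<^sup>2 * l2sq f"
    if "f \<in> L2plus" for f
    using bd L2plus_bounded_mult[OF that, of "\<lambda>x. complex_of_real (p x)" c]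
      L2plus_bounded_mult[OF that, of "\<lambda>x. complex_of_real (q x)" c] by simp_all
  show "mulop p q u \<in> Hsp" if "u \<in> Hsp" for u
    using that p(1) q(1) by (simp add: Hsp_def mulop_def mem_Times_iff)
  show "mulop p q (hlin c u v) = hlin c (mulop p q u) (mulop p q v)" for c u v
    by (simp add: mulop_def hlin_def algebra_simps)
  show "(hnorm (mulop p q u))\<^sup>2 \<le> c\<^sup>2 * (hnorm u)\<^sup>2" if "u \<in> Hsp" for u
    using that p(2)[of "fst u"] q(2)[of "snd u"]
    by (auto simp: hnorm_sq mulop_def Hsp_def distrib_left)
qed

lemma nn2_weighted:
  assumes "\<And>x. 0 \<le> w x"
  shows "nn2 (\<lambda>x. complex_of_real (sqrt (w x)) * f x) = (\<integral>\<^sup>+x. ennreal (w x) * ennreal ((cmod (cut f x))\<^sup>2) \<partial>lborel)"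
  unfolding nn2_def
proof (rule nn_integral_cong)
  fix x :: real
  have "(cmod (cut (\<lambda>x. complex_of_real (sqrt (w x)) * f x) x))\<^sup>2 = w x * (cmod (cut f x))\<^sup>2"
    using assms by (cases "0 \<le> x") (simp_all add: norm_mult power_mult_distrib)
  then show "ennreal ((cmod (cut (\<lambda>x. complex_of_real (sqrt (w x)) * f x) x))\<^sup>2)
    = ennreal (w x) * ennreal ((cmod (cut f x))\<^sup>2)"
    using assms by (simp add: ennreal_mult)
qed

text \<open>\<open>W\<close> is exp(\<mu> x) capped by exp(\<mu> a_n) / 2 for every a_n >= x. Thus
  exp(-\<mu> x) W(x) stays in [1/2, 1], is at most 1/2 at a_n, and tends to 1 from the right of it.
  The gap hypothesis keeps the caps of later points from spoiling this jump.\<close>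

lemma left_weight_exists:
  fixes a :: "int \<Rightarrow> real"
  assumes mu: "0 \<le> \<mu>"
    and gap: "\<And>n m. n \<in> J \<Longrightarrow> m \<in> J \<Longrightarrow> a n < a m \<Longrightarrow> 2 * exp (\<mu> * a n) \<le> exp (\<mu> * a m)"
  obtains W where "mono W" "\<And>x. exp (\<mu> * x) / 2 \<le> W x" "\<And>x. W x \<le> exp (\<mu> * x)"
    "\<And>x n. n \<in> J \<Longrightarrow> x \<le> a n \<Longrightarrow> 2 * W x \<le> exp (\<mu> * a n)"
    "\<And>x n. n \<in> J \<Longrightarrow> a n < x \<Longrightarrow> exp (\<mu> * a n) \<le> W x"
proof -
  define A where "A x = insert (exp (\<mu> * x)) {exp (\<mu> * a n) / 2 | n. n \<in> J \<and> x \<le> a n}" for x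
  define W where "W x = Inf (A x)" for x
  have ne: "A x \<noteq> {}" for x by (simp add: A_def)
  have low: "exp (\<mu> * x) / 2 \<le> z" if "z \<in> A x" for x z
    using that mu by (auto simp: A_def mult_left_mono)
  then have bdd: "bdd_below (A x)" for x by (rule bdd_belowI)
  have le: "W x \<le> z" if "z \<in> A x" for x z
    unfolding W_def by (rule cInf_lower[OF that bdd])
  have ge: "B \<le> W x" if "\<And>z. z \<in> A x \<Longrightarrow> B \<le> z" for B x
    unfolding W_def by (rule cInf_greatest[OF ne that])
  show thesis
  proof
    show "mono W"
    proof
      fix x y :: real assume xy: "x \<le> y"
      show "W x \<le> W y"
      proof (rule ge)
        fix z assume "z \<in> A y"
        then consider "z = exp (\<mu> * y)" | n where "n \<in> J" "y \<le> a n" "z = exp (\<mu> * a n) / 2"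
          by (auto simp: A_def)
        then show "W x \<le> z"
        proof cases
          case 1
          have "W x \<le> exp (\<mu> * x)" by (rule le) (simp add: A_def)
          also have "\<dots> \<le> z" using xy mu by (simp add: 1 mult_left_mono)
          finally show ?thesis .
        next
          case 2
          then show ?thesis using xy by (intro le) (auto simp: A_def)
        qed
      qed
    qed
    show "exp (\<mu> * x) / 2 \<le> W x" for x using low by (rule ge)
    show "W x \<le> exp (\<mu> * x)" for x by (rule le) (simp add: A_def)
    show "2 * W x \<le> exp (\<mu> * a n)" if "n \<in> J" "x \<le> a n" for x n
    proof -
      have "exp (\<mu> * a n) / 2 \<in> A x" using that by (auto simp: A_def)
      from le[OF this] show ?thesis by simp
    qed
    show "exp (\<mu> * a n) \<le> W x" if "n \<in> J" "a n < x" for x n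
    proof (rule ge)
      fix z assume "z \<in> A x"
      then consider "z = exp (\<mu> * x)" | m where "m \<in> J" "x \<le> a m" "z = exp (\<mu> * a m) / 2"
        by (auto simp: A_def)
      then show "exp (\<mu> * a n) \<le> z"
        using that mu gap[of n] by cases (fastforce simp: mult_left_mono)+
    qed
  qed
qed

text \<open>The mirror image of the left weight: reflect the line, so that the points become -a_n,
  and set U(x) = 2 W(-x).\<close>

lemma right_weight_exists:
  fixes a :: "int \<Rightarrow> real"
  assumes mu: "0 \<le> \<mu>"
    and gap: "\<And>n m. n \<in> J \<Longrightarrow> m \<in> J \<Longrightarrow> a n < a m \<Longrightarrow> 2 * exp (\<mu> * a n) \<le> exp (\<mu> * a m)"
  obtains U where "antimono U" "\<And>x. exp (- (\<mu> * x)) \<le> U x" "\<And>x. U x \<le> 2 * exp (- (\<mu> * x))"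
    "\<And>x n. n \<in> J \<Longrightarrow> x < a n \<Longrightarrow> 2 * exp (- (\<mu> * a n)) \<le> U x"
    "\<And>x n. n \<in> J \<Longrightarrow> a n \<le> x \<Longrightarrow> U x \<le> exp (- (\<mu> * a n))"
proof -
  obtain W where W: "mono W" "\<And>x. exp (\<mu> * x) / 2 \<le> W x" "\<And>x. W x \<le> exp (\<mu> * x)"
    "\<And>x n. n \<in> uminus ` J \<Longrightarrow> x \<le> - a (- n) \<Longrightarrow> 2 * W x \<le> exp (\<mu> * - a (- n))"
    "\<And>x n. n \<in> uminus ` J \<Longrightarrow> - a (- n) < x \<Longrightarrow> exp (\<mu> * - a (- n)) \<le> W x"
  proof (rule left_weight_exists[OF mu, of "uminus ` J" "\<lambda>n. - a (- n)"])
    fix n m assume "n \<in> uminus ` J" "m \<in> uminus ` J" "- a (- n) < - a (- m)"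
    then show "2 * exp (\<mu> * - a (- n)) \<le> exp (\<mu> * - a (- m))"
      using gap[of "- m" "- n"] by (auto simp: exp_minus field_simps)
  qed blast
  have im: "- n \<in> uminus ` J" if "n \<in> J" for n using that by auto
  show thesis
  proof
    show "antimono (\<lambda>x. 2 * W (- x))" using W(1) by (auto simp: monotone_def)
    show "exp (- (\<mu> * x)) \<le> 2 * W (- x)" for x using W(2)[of "- x"] by simp
    show "2 * W (- x) \<le> 2 * exp (- (\<mu> * x))" for x using W(3)[of "- x"] by simp
    show "2 * exp (- (\<mu> * a n)) \<le> 2 * W (- x)" if "n \<in> J" "x < a n" for x n
      using W(5)[OF im[OF that(1)], of "- x"] that by simp
    show "2 * W (- x) \<le> exp (- (\<mu> * a n))" if "n \<in> J" "a n \<le> x" for x n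
      using W(4)[OF im[OF that(1)], of "- x"] that by simp
  qed
qed

context doubling
begin

text \<open>Crossing \<open>a n\<close>, the incoming pair \<open>(f (a n +), g (a n -)) = (p, q)\<close> leaves as
  \<open>(f (a n -), g (a n +)) = (p + q, q)\<close>. The weights satisfy \<open>w (a n -) = 1 / 2\<close>, \<open>w (a n +) = 1\<close>,
  \<open>v (a n -) = 2\<close>, \<open>v (a n +) = 1\<close>, and \<open>\<bar>p + q\<bar>\<^sup>2 / 2 + \<bar>q\<bar>\<^sup>2 \<le> \<bar>p\<bar>\<^sup>2 + 2 * \<bar>q\<bar>\<^sup>2\<close>. The exponential factor lets the
  weights recover between consecutive points, whose distance is at least \<open>a 0\<close>.\<close>
lemma similar_to_quasicontraction_Ta:
  assumes JE: "J = {0..}"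
  shows "similar_to_quasicontraction (Ta J a)"
proof -
  have a0: "0 < a 0" using pos JE by simp
  \<comment> \<open>The rate for which the weights recover a factor 2 over the minimal gap
    a_0.\<close>
  define \<mu> where "\<mu> = ln 2 / a 0"
  have mu: "0 < \<mu>" using a0 by (simp add: \<mu>_def)
  have mua0: "exp (\<mu> * a 0) = 2" using a0 by (simp add: \<mu>_def)
  have gap: "2 * exp (\<mu> * a n) \<le> exp (\<mu> * a m)" if n: "n \<in> J" and m: "m \<in> J" and "a n < a m" for n m
  proof -
    have "n < m" using a_mono[OF m n] \<open>a n < a m\<close> by (rule_tac ccontr) auto
    then have "a 0 + a n \<le> a m" using gr[OF n m] a_mono[of 0 n] n JE by auto
    then have "exp (\<mu> * (a 0 + a n)) \<le> exp (\<mu> * a m)" using mu by simp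
    then show ?thesis by (simp add: distrib_left exp_add mua0)
  qed
  obtain W where W: "mono W" "\<And>x. exp (\<mu> * x) / 2 \<le> W x" "\<And>x. W x \<le> exp (\<mu> * x)"
    "\<And>x n. n \<in> J \<Longrightarrow> x \<le> a n \<Longrightarrow> 2 * W x \<le> exp (\<mu> * a n)"
    "\<And>x n. n \<in> J \<Longrightarrow> a n < x \<Longrightarrow> exp (\<mu> * a n) \<le> W x"
    using left_weight_exists[of \<mu> J a] mu gap by (metis less_imp_le)
  obtain U where U: "antimono U" "\<And>x. exp (- (\<mu> * x)) \<le> U x" "\<And>x. U x \<le> 2 * exp (- (\<mu> * x))"
    "\<And>x n. n \<in> J \<Longrightarrow> x < a n \<Longrightarrow> 2 * exp (- (\<mu> * a n)) \<le> U x"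
    "\<And>x n. n \<in> J \<Longrightarrow> a n \<le> x \<Longrightarrow> U x \<le> exp (- (\<mu> * a n))"
    using right_weight_exists[of \<mu> J a] mu gap by (metis less_imp_le)
  \<comment> \<open>Without the exponential, \<open>w\<close> lies in [1/2, 1] and \<open>v\<close>
    in [1, 2], so the weighted norm is equivalent to the original one.\<close>
  define w where "w x = exp (- (\<mu> * x)) * W x" for x
  define v where "v x = exp (\<mu> * x) * U x" for x
  have [measurable]: "W \<in> borel_measurable borel" "U \<in> borel_measurable borel"
    using borel_measurable_mono[OF W(1)] borel_measurable_mono[of "\<lambda>x. - U x"] U(1)
    by (auto simp: monotone_def)
  have [measurable]: "w \<in> borel_measurable borel" "v \<in> borel_measurable borel"
    unfolding w_def v_def by measurable
  have w: "1 / 2 \<le> w x" "w x \<le> 1" for x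
    using W(2,3)[of x] by (simp_all add: w_def exp_minus field_simps)
  have v: "1 \<le> v x" "v x \<le> 2" for x
    using U(2,3)[of x] by (simp_all add: v_def exp_minus field_simps)
  have w0: "0 \<le> w x" and v0: "0 \<le> v x" for x using w[of x] v[of x] by auto

  have ex: "exp (- (\<mu> * x)) * W (x + t) = exp (\<mu> * t) * w (x + t)" for x t
  proof -
    have "exp (- (\<mu> * x)) = exp (\<mu> * t) * exp (- (\<mu> * (x + t)))"
      by (simp add: exp_add[symmetric] distrib_left)
    then show ?thesis by (simp add: w_def)
  qed
  have wshift: "w x \<le> exp (\<mu> * t) * w (x + t)" if "0 \<le> t" for x t
  proof -
    have "exp (- (\<mu> * x)) * W x \<le> exp (- (\<mu> * x)) * W (x + t)"
      using that W(1) by (intro mult_left_mono) (auto simp: monoD)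
    also have "\<dots> = exp (\<mu> * t) * w (x + t)"
      by (rule ex)
    finally show ?thesis by (simp add: w_def)
  qed
  \<comment> \<open>Moving left from x + t to x, the particle crosses a_n, where the weight drops by
    half. The factor gained pays for the 2 in \<open>cmod_add_sq_le\<close>.\<close>
  have wshift2: "2 * w x \<le> exp (\<mu> * t) * w (x + t)" if "x \<in> E t n" for x t n
  proof -
    have "exp (- (\<mu> * x)) * (2 * W x) \<le> exp (- (\<mu> * x)) * W (x + t)"
      using that W(4)[of n x] W(5)[of n "x + t"] by (intro mult_left_mono) (auto simp: E_def)
    also have "\<dots> = exp (\<mu> * t) * w (x + t)"
      by (rule ex)
    finally show ?thesis by (simp add: w_def)
  qed
  have vshift: "v (y + t) \<le> exp (\<mu> * t) * v y" if "0 \<le> t" for y t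
  proof -
    have "exp (\<mu> * (y + t)) * U (y + t) \<le> exp (\<mu> * (y + t)) * U y"
      using that U(1) by (intro mult_left_mono) (auto simp: antimonoD)
    then show ?thesis by (simp add: v_def exp_add distrib_left mult_ac)
  qed
  \<comment> \<open>Energy balance of g(y) crossing a_n: the reflected copy, doubled because of
    \<open>cmod_add_sq_le\<close>, and the transmitted part are each at most
    \<open>?e * exp (- (\<mu> * a n))\<close>, while the weight before the crossing provides twice
    this amount.\<close>
  have vshift2: "2 * w (2 * a n - y - t) + v (y + t) \<le> exp (\<mu> * t) * v y"
    if n: "n \<in> J" and y: "a n \<le> y + t" "y < a n" for n y t
  proof -
    let ?e = "exp (\<mu> * (y + t))"
    have "2 * w (2 * a n - y - t) \<le> exp (- (\<mu> * (2 * a n - y - t))) * exp (\<mu> * a n)"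
      using W(4)[OF n, of "2 * a n - y - t"] y by (simp add: w_def)
    also have "\<dots> = ?e * exp (- (\<mu> * a n))"
      by (simp add: exp_add[symmetric] algebra_simps)
    finally have "2 * w (2 * a n - y - t) \<le> ?e * exp (- (\<mu> * a n))" .
    moreover have "v (y + t) \<le> ?e * exp (- (\<mu> * a n))"
      using U(5)[OF n y(1)] by (simp add: v_def)
    moreover have "?e * (2 * exp (- (\<mu> * a n))) \<le> ?e * U y"
      using U(4)[OF n y(2)] by simp
    moreover have "?e * U y = exp (\<mu> * t) * v y"
      by (simp add: v_def exp_add distrib_left mult_ac)
    ultimately show ?thesis by linarith
  qed

  define En where "En u = (\<integral>\<^sup>+x. ennreal (w x) * ennreal ((cmod (cut (fst u) x))\<^sup>2) \<partial>lborel)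
    + (\<integral>\<^sup>+x. ennreal (v x) * ennreal ((cmod (cut (snd u) x))\<^sup>2) \<partial>lborel)" for u
  have energy: "En (Ta J a t u) \<le> ennreal (exp (\<mu> * t)) * En u" if u: "u \<in> Hsp" and t: "0 \<le> t" for u t
  proof -
    define f where "f = fst u"
    define g where "g = snd u"
    have [measurable]: "cut f \<in> borel_measurable borel" "cut g \<in> borel_measurable borel"
      using u by (auto simp: f_def g_def Hsp_def L2plus_iff)
    have [measurable]: "Vop J a t g \<in> borel_measurable borel" by (rule Vop_measurable) simp
    have T: "fst (Ta J a t u) = Lsh t f + Vop J a t g" "snd (Ta J a t u) = Rsh t g"
      by (simp_all add: Ta_eq f_def g_def)
    let ?e = "exp (\<mu> * t)"
    have "(\<integral>\<^sup>+x. ennreal (w x) * ennreal ((cmod (cut (Lsh t f + Vop J a t g) x))\<^sup>2) \<partial>lborel)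
      \<le> (\<integral>\<^sup>+x. ennreal ?e * (ennreal (w (x + t)) * ennreal ((cmod (cut f (x + t)))\<^sup>2))
          + ennreal (2 * w x) * ennreal ((cmod (Vop J a t g x))\<^sup>2) \<partial>lborel)"
    proof (rule nn_integral_mono)
      fix x :: real
      have "w x * (cmod (cut (Lsh t f + Vop J a t g) x))\<^sup>2
        \<le> ?e * (w (x + t) * (cmod (cut f (x + t)))\<^sup>2) + 2 * w x * (cmod (Vop J a t g x))\<^sup>2"
      proof (cases "0 \<le> x")
        case True
        then have L: "cut (Lsh t f + Vop J a t g) x = cut f (x + t) + Vop J a t g x"
          using t by (simp add: Lsh_def)
        show ?thesis
        \<comment> \<open>The lossy \<open>cmod_add_sq_le\<close> is applied only where a reflected
          copy can be present, which is where \<open>wshift2\<close> compensates for it.\<close>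
        proof (cases "\<exists>n. x \<in> E t n")
          case True
          then obtain n where n: "x \<in> E t n" by blast
          have "w x * (cmod (cut (Lsh t f + Vop J a t g) x))\<^sup>2
            \<le> w x * (2 * (cmod (cut f (x + t)))\<^sup>2 + 2 * (cmod (Vop J a t g x))\<^sup>2)"
            unfolding L using w0 by (intro mult_left_mono cmod_add_sq_le)
          also have "\<dots> = (2 * w x) * (cmod (cut f (x + t)))\<^sup>2 + 2 * w x * (cmod (Vop J a t g x))\<^sup>2"
            by (simp add: algebra_simps)
          also have "\<dots> \<le> (?e * w (x + t)) * (cmod (cut f (x + t)))\<^sup>2 + 2 * w x * (cmod (Vop J a t g x))\<^sup>2"
            by (intro add_right_mono mult_right_mono wshift2[OF n]) simp
          finally show ?thesis by (simp add: mult.assoc)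
        next
          case False
          then have "Vop J a t g x = 0" by (intro Vop_zero) auto
          then show ?thesis unfolding L
            using mult_right_mono[OF wshift[OF t, of x], of "(cmod (cut f (x + t)))\<^sup>2"] by (simp add: mult.assoc)
        qed
      next
        case False
        then show ?thesis using w0 by simp
      qed
      then have "ennreal (w x * (cmod (cut (Lsh t f + Vop J a t g) x))\<^sup>2)
        \<le> ennreal (?e * (w (x + t) * (cmod (cut f (x + t)))\<^sup>2) + 2 * w x * (cmod (Vop J a t g x))\<^sup>2)"
        by (rule ennreal_leI)
      then show "ennreal (w x) * ennreal ((cmod (cut (Lsh t f + Vop J a t g) x))\<^sup>2)
        \<le> ennreal ?e * (ennreal (w (x + t)) * ennreal ((cmod (cut f (x + t)))\<^sup>2))
          + ennreal (2 * w x) * ennreal ((cmod (Vop J a t g x))\<^sup>2)"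
        using w0 by (simp add: ennreal_plus ennreal_mult del: cut_nonneg)
    qed
    also have "\<dots> = ennreal ?e * (\<integral>\<^sup>+x. ennreal (w (x + t)) * ennreal ((cmod (cut f (x + t)))\<^sup>2) \<partial>lborel)
        + (\<integral>\<^sup>+x. ennreal (2 * w x) * ennreal ((cmod (Vop J a t g x))\<^sup>2) \<partial>lborel)"
      by (simp add: nn_integral_add nn_integral_cmult)
    also have "(\<integral>\<^sup>+x. ennreal (w (x + t)) * ennreal ((cmod (cut f (x + t)))\<^sup>2) \<partial>lborel)
        = (\<integral>\<^sup>+x. ennreal (w x) * ennreal ((cmod (cut f x))\<^sup>2) \<partial>lborel)"
      using nn_integral_real_affine[of "\<lambda>x. ennreal (w x) * ennreal ((cmod (cut f x))\<^sup>2)" 1 t]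
      by (simp add: add.commute)
    finally have 1: "(\<integral>\<^sup>+x. ennreal (w x) * ennreal ((cmod (cut (Lsh t f + Vop J a t g) x))\<^sup>2) \<partial>lborel)
      \<le> ennreal ?e * (\<integral>\<^sup>+x. ennreal (w x) * ennreal ((cmod (cut f x))\<^sup>2) \<partial>lborel)
        + (\<integral>\<^sup>+x. ennreal (2 * w x) * ennreal ((cmod (Vop J a t g x))\<^sup>2) \<partial>lborel)" .

    \<comment> \<open>The doubled weight that the reflected copy of g(y), if there is one, carries
      at time t.\<close>
    define S where "S y = (\<Sum>k. indicator (E t (int_decode k) - {0}) (2 * a (int_decode k) - y - t)
          * ennreal (2 * w (2 * a (int_decode k) - y - t)))" for y
    have [measurable]: "S \<in> borel_measurable borel" unfolding S_def by measurable
    have V: "(\<integral>\<^sup>+x. ennreal (2 * w x) * ennreal ((cmod (Vop J a t g x))\<^sup>2) \<partial>lborel)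
        = (\<integral>\<^sup>+y. S y * ennreal ((cmod (cut g y))\<^sup>2) \<partial>lborel)"
      unfolding S_def by (rule nn_integral_Vop) auto
    have R: "(\<integral>\<^sup>+x. ennreal (v x) * ennreal ((cmod (cut (Rsh t g) x))\<^sup>2) \<partial>lborel)
        = (\<integral>\<^sup>+y. ennreal (v (y + t)) * ennreal ((cmod (cut g y))\<^sup>2) \<partial>lborel)"
      using nn_integral_real_affine[of "\<lambda>x. ennreal (v x) * ennreal ((cmod (cut g (x - t)))\<^sup>2)" 1 t]
      by (simp add: cut_Rsh[OF t] add.commute)
    have 2: "S y * ennreal ((cmod (cut g y))\<^sup>2) + ennreal (v (y + t)) * ennreal ((cmod (cut g y))\<^sup>2)
      \<le> ennreal ?e * (ennreal (v y) * ennreal ((cmod (cut g y))\<^sup>2))" for y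
    proof -
      have "S y \<le> ennreal (?e * v y - v (y + t))"
        unfolding S_def by (rule reflected_sum_le) (use vshift2 in \<open>auto intro!: ennreal_leI simp: le_diff_eq\<close>)
      then have "S y + ennreal (v (y + t)) \<le> ennreal (?e * v y - v (y + t)) + ennreal (v (y + t))"
        by (rule add_right_mono)
      also have "\<dots> = ennreal (?e * v y)"
        using vshift[OF t, of y] v0[of "y + t"] by (simp add: ennreal_plus[symmetric] del: ennreal_plus)
      finally have "(S y + ennreal (v (y + t))) * ennreal ((cmod (cut g y))\<^sup>2)
          \<le> ennreal (?e * v y) * ennreal ((cmod (cut g y))\<^sup>2)"
        by (rule mult_right_mono) simp
      then show ?thesis using v0 by (simp add: distrib_right ennreal_mult mult.assoc)
    qed
    have "En (Ta J a t u) \<le> ennreal ?e * (\<integral>\<^sup>+x. ennreal (w x) * ennreal ((cmod (cut f x))\<^sup>2) \<partial>lborel)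
       + ((\<integral>\<^sup>+y. S y * ennreal ((cmod (cut g y))\<^sup>2) \<partial>lborel)
       + (\<integral>\<^sup>+y. ennreal (v (y + t)) * ennreal ((cmod (cut g y))\<^sup>2) \<partial>lborel))"
      using add_right_mono[OF 1] by (simp add: En_def T V R add.assoc)
    also have "(\<integral>\<^sup>+y. S y * ennreal ((cmod (cut g y))\<^sup>2) \<partial>lborel)
       + (\<integral>\<^sup>+y. ennreal (v (y + t)) * ennreal ((cmod (cut g y))\<^sup>2) \<partial>lborel)
       = (\<integral>\<^sup>+y. S y * ennreal ((cmod (cut g y))\<^sup>2) + ennreal (v (y + t)) * ennreal ((cmod (cut g y))\<^sup>2) \<partial>lborel)"
      by (rule nn_integral_add[symmetric]) auto
    also have "\<dots> \<le> (\<integral>\<^sup>+y. ennreal ?e * (ennreal (v y) * ennreal ((cmod (cut g y))\<^sup>2)) \<partial>lborel)"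
      by (rule nn_integral_mono) (rule 2)
    also have "\<dots> = ennreal ?e * (\<integral>\<^sup>+y. ennreal (v y) * ennreal ((cmod (cut g y))\<^sup>2) \<partial>lborel)"
      by (rule nn_integral_cmult) simp
    finally show ?thesis
      by (simp add: En_def f_def g_def distrib_left add_left_mono)
  qed

  define S where "S = mulop (\<lambda>x. sqrt (w x)) (\<lambda>x. sqrt (v x))"
  define S' where "S' = mulop (\<lambda>x. 1 / sqrt (w x)) (\<lambda>x. 1 / sqrt (v x))"
  have S: "bounded_op S" unfolding S_def
  proof (rule bounded_op_mulop[where c = "sqrt 2"])
    show "\<bar>sqrt (w x)\<bar> \<le> sqrt 2" "\<bar>sqrt (v x)\<bar> \<le> sqrt 2" for x
      using w[of x] v[of x] by auto
  qed auto
  have S': "bounded_op S'" unfolding S'_def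
  proof (rule bounded_op_mulop[where c = "sqrt 2"])
    have "sqrt (1 / w x) \<le> sqrt 2" "sqrt (1 / v x) \<le> sqrt 2" for x
      using w[of x] v[of x] by (auto simp: field_simps simp del: real_sqrt_divide)
    then show "\<bar>1 / sqrt (w x)\<bar> \<le> sqrt 2" "\<bar>1 / sqrt (v x)\<bar> \<le> sqrt 2" for x
      using w0[of x] v0[of x] by (simp_all add: real_sqrt_divide)
  qed auto
  have wv: "w x \<noteq> 0" "v x \<noteq> 0" for x using w[of x] v[of x] by auto
  have SS: "S (S' u) = u" "S' (S u) = u" for u
    using wv by (simp_all add: S_def S'_def mulop_def)
  then have inv: "inverse_ops S S'"
    using S S' by (simp add: inverse_ops_def)
  have HS: "S u \<in> Hsp" "S' u \<in> Hsp" if "u \<in> Hsp" for u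
    using that S S' by (auto simp: bounded_op_def)
  have En: "En u = ennreal ((hnorm (S u))\<^sup>2)" if "u \<in> Hsp" for u
  proof -
    have "fst (S u) \<in> L2plus" "snd (S u) \<in> L2plus" using HS(1)[OF that] by (auto simp: Hsp_def)
    then show ?thesis
      using nn2_weighted[of w "fst u", OF w0] nn2_weighted[of v "snd u", OF v0]
      by (simp add: En_def hnorm_sq S_def mulop_def nn2_eq[symmetric] ennreal_plus)
  qed
  \<comment> \<open>The energy is quadratic, so the norm grows at half the rate.\<close>
  have "hnorm (S (Ta J a t (S' u))) \<le> exp (\<mu> / 2 * t) * hnorm u" if t: "0 \<le> t" and u: "u \<in> Hsp" for t u
  proof -
    have "ennreal ((hnorm (S (Ta J a t (S' u))))\<^sup>2) \<le> ennreal (exp (\<mu> * t) * (hnorm u)\<^sup>2)"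
      using energy[OF HS(2)[OF u] t] En[OF HS(2)[OF u]] En[OF Ta_Hsp[OF HS(2)[OF u] t]]
      by (simp add: SS ennreal_mult)
    then have "(hnorm (S (Ta J a t (S' u))))\<^sup>2 \<le> exp (\<mu> * t) * (hnorm u)\<^sup>2"
      by (subst (asm) ennreal_le_iff) auto
    also have "\<dots> = (exp (\<mu> / 2 * t) * hnorm u)\<^sup>2"
      by (simp add: power_mult_distrib exp_double[symmetric])
    finally show ?thesis by (rule power2_le_imp_le) simp
  qed
  with inv show ?thesis unfolding similar_to_quasicontraction_def by blast
qed

end

section \<open>Averages over an orbit\<close>

lemma sum_lessThan_add:
  fixes f :: "nat \<Rightarrow> 'v :: ab_group_add"
  shows "sum f {..<m + n} = sum f {..<m} + (\<Sum>i<n. f (m + i))"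
  by (induction n) (simp_all add: add.assoc)

text \<open>Cauchy-Schwarz without an inner product: the two-term inequality is iterated along a
  binary tree, which is why the number of summands is a power of 2.\<close>

lemma dyadic_sum_le:
  fixes Q :: "'v :: ab_group_add \<Rightarrow> real" and p :: "nat \<Rightarrow> 'v"
  assumes H: "\<And>x y. x \<in> H \<Longrightarrow> y \<in> H \<Longrightarrow> x + y \<in> H"
    and Q: "\<And>x y. x \<in> H \<Longrightarrow> y \<in> H \<Longrightarrow> Q (x + y) \<le> 2 * Q x + 2 * Q y"
    and p: "\<And>i. i < 2 ^ m \<Longrightarrow> p i \<in> H"
  shows "(\<Sum>i<2 ^ m. p i) \<in> H \<and> Q (\<Sum>i<2 ^ m. p i) \<le> 2 ^ m * (\<Sum>i<2 ^ m. Q (p i))"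
  using p
proof (induction m arbitrary: p)
  case 0
  have "{..<(2::nat) ^ 0} = {0}" by auto
  then show ?case using 0[of 0] by (simp only:) simp
next
  case (Suc m)
  let ?x = "\<Sum>i<2 ^ m. p i" and ?y = "\<Sum>i<2 ^ m. p (2 ^ m + i)"
  have IH: "?x \<in> H \<and> Q ?x \<le> 2 ^ m * (\<Sum>i<2 ^ m. Q (p i))"
    "?y \<in> H \<and> Q ?y \<le> 2 ^ m * (\<Sum>i<2 ^ m. Q (p (2 ^ m + i)))"
    by (intro Suc; simp)+
  have split: "(\<Sum>i<2 ^ Suc m. f i) = (\<Sum>i<2 ^ m. f i) + (\<Sum>i<2 ^ m. f (2 ^ m + i))"
    for f :: "nat \<Rightarrow> 'w :: ab_group_add"
    using sum_lessThan_add[of f "2 ^ m" "2 ^ m"] by (simp add: mult_2)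
  have "Q (?x + ?y) \<le> 2 * Q ?x + 2 * Q ?y" using IH by (intro Q) auto
  also have "\<dots> \<le> 2 ^ Suc m * ((\<Sum>i<2 ^ m. Q (p i)) + (\<Sum>i<2 ^ m. Q (p (2 ^ m + i))))"
    using IH by (simp add: algebra_simps)
  finally show ?case unfolding split using IH H by blast
qed

text \<open>\<open>Q x = N x - N (D ^^ 3 x) / \<omega> ^ 3\<close> is a positive semidefinite quadratic form, and along
  the orbit of \<open>u\<close> its values telescope. Hence \<open>Q\<close> is small on averages of the orbit, whereas
  \<open>Q = N\<close> on vectors that are annihilated by \<open>D ^^ 3\<close>.\<close>
lemma orbit_average_bound:
  fixes N :: "'v :: ab_group_add \<Rightarrow> real"
  assumes H: "\<And>x y. x \<in> H \<Longrightarrow> y \<in> H \<Longrightarrow> x + y \<in> H" "\<And>x y. x \<in> H \<Longrightarrow> y \<in> H \<Longrightarrow> x - y \<in> H"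
    and N: "\<And>x. 0 \<le> N x"
    and para: "\<And>x y. x \<in> H \<Longrightarrow> y \<in> H \<Longrightarrow> N (x + y) + N (x - y) = 2 * N x + 2 * N y"
    and D: "\<And>x. x \<in> H \<Longrightarrow> D x \<in> H" "\<And>x y. D (x + y) = D x + D y" "\<And>x y. D (x - y) = D x - D y"
    and contr: "\<And>x. x \<in> H \<Longrightarrow> N (D x) \<le> \<omega> * N x" and \<omega>: "1 \<le> \<omega>"
    and u: "u \<in> H"
    and k: "\<And>i. i < 2 ^ m \<Longrightarrow> k i + 3 \<le> k (Suc i)" "\<And>i. i < 2 ^ m \<Longrightarrow> \<omega> ^ k i \<le> 2"
    and hr: "\<And>i. i < 2 ^ m \<Longrightarrow> (D ^^ k i) u = h i + r i"
      "\<And>i. i < 2 ^ m \<Longrightarrow> h i \<in> H" "\<And>i. i < 2 ^ m \<Longrightarrow> r i \<in> H"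
    and exit: "N ((D ^^ 3) (\<Sum>i<2 ^ m. h i)) = 0"
  shows "N (\<Sum>i<2 ^ m. h i) \<le> 4 * 2 ^ m * N u + 2 * N (\<Sum>i<2 ^ m. r i)"
proof -
  have DkH: "(D ^^ j) x \<in> H" if "x \<in> H" for j x using that D(1) by (induction j) auto
  have Dk: "(D ^^ j) (x + y) = (D ^^ j) x + (D ^^ j) y" "(D ^^ j) (x - y) = (D ^^ j) x - (D ^^ j) y" for j x y
    using D(2,3) by (induction j) simp_all
  have Nk: "N ((D ^^ j) x) \<le> \<omega> ^ j * N x" if "x \<in> H" for j x
  proof (induction j)
    case (Suc j)
    have "N ((D ^^ Suc j) x) \<le> \<omega> * N ((D ^^ j) x)" using contr[OF DkH[OF that, of j]] by simp
    also have "\<dots> \<le> \<omega> * (\<omega> ^ j * N x)" using Suc \<omega> by (intro mult_left_mono) auto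
    finally show ?case by (simp add: mult.assoc)
  qed simp
  define Q where "Q x = N x - N ((D ^^ 3) x) / \<omega> ^ 3" for x
  have Q0: "0 \<le> Q x" if "x \<in> H" for x
    using Nk[OF that, of 3] \<omega> by (simp add: Q_def field_simps)
  have Qpara: "Q (x + y) + Q (x - y) = 2 * Q x + 2 * Q y" if "x \<in> H" "y \<in> H" for x y
  proof -
    have "N ((D ^^ 3) (x + y)) / \<omega> ^ 3 + N ((D ^^ 3) (x - y)) / \<omega> ^ 3
        = 2 * (N ((D ^^ 3) x) / \<omega> ^ 3) + 2 * (N ((D ^^ 3) y) / \<omega> ^ 3)"
      using para[OF DkH[OF that(1), of 3] DkH[OF that(2), of 3]]
      by (simp add: Dk add_divide_distrib[symmetric])
    then show ?thesis using para[OF that] by (simp add: Q_def)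
  qed
  have Qle: "Q (x + y) \<le> 2 * Q x + 2 * Q y" "Q (x - y) \<le> 2 * Q x + 2 * Q y" if "x \<in> H" "y \<in> H" for x y
    using Qpara[OF that] Q0[OF H(1)[OF that]] Q0[OF H(2)[OF that]] by auto
  define p where "p i = (D ^^ k i) u" for i
  have pH: "p i \<in> H" for i unfolding p_def using u by (rule DkH)
  \<comment> \<open>The rescaled energy, which decreases along the orbit.\<close>
  define q where "q j = N ((D ^^ j) u) / \<omega> ^ j" for j
  have qdec: "q (Suc j) \<le> q j" for j
    using contr[OF DkH[OF u, of j]] \<omega> by (simp add: q_def field_simps)
  have qanti: "q j \<le> q i" if "i \<le> j" for i j
    using qdec that by (rule lift_Suc_antimono_le)
  have Qp: "Q (p i) \<le> 2 * (q (k i) - q (k (Suc i)))" if i: "i < 2 ^ m" for i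
  proof -
    \<comment> \<open>\<open>Q (p i)\<close> is a multiple of the drop of \<open>q\<close> from k_i
      to k_i + 3. These ranges do not overlap, so the drops add up to at most q(0).\<close>
    have "Q (p i) = \<omega> ^ k i * (q (k i) - q (k i + 3))"
      using \<omega> by (simp add: Q_def p_def q_def funpow_add[symmetric, THEN fun_cong, simplified] add.commute power_add field_simps)
    also have "\<dots> \<le> 2 * (q (k i) - q (k i + 3))"
      using k(2)[OF i] qanti[of "k i" "k i + 3"] by (intro mult_right_mono) auto
    also have "\<dots> \<le> 2 * (q (k i) - q (k (Suc i)))"
      using qanti[OF k(1)[OF i]] by simp
    finally show ?thesis .
  qed
  have tele: "(\<Sum>i<j. q (k i) - q (k (Suc i))) = q (k 0) - q (k j)" for j
    by (rule sum_lessThan_telescope')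
  have "(\<Sum>i<2 ^ m. Q (p i)) \<le> (\<Sum>i<2 ^ m. 2 * (q (k i) - q (k (Suc i))))"
    using Qp by (intro sum_mono) auto
  also have "\<dots> = 2 * (q (k 0) - q (k (2 ^ m)))"
    by (simp only: sum_distrib_left[symmetric] tele)
  also have "\<dots> \<le> 2 * q 0"
  proof -
    have "0 \<le> q (k (2 ^ m))" using N \<omega> by (simp add: q_def)
    then show ?thesis using qanti[OF le0, of "k 0"] by argo
  qed
  finally have sumQ: "(\<Sum>i<2 ^ m. Q (p i)) \<le> 2 * N u" by (simp add: q_def)
  have P: "(\<Sum>i<2 ^ m. p i) \<in> H \<and> Q (\<Sum>i<2 ^ m. p i) \<le> 2 ^ m * (\<Sum>i<2 ^ m. Q (p i))"
    using H(1) Qle(1) pH by (rule dyadic_sum_le)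
  have R: "(\<Sum>i<2 ^ m. r i) \<in> H"
    using dyadic_sum_le[of H Q m r, OF H(1) Qle(1) hr(3)] by blast
  have eq: "(\<Sum>i<2 ^ m. h i) = (\<Sum>i<2 ^ m. p i) - (\<Sum>i<2 ^ m. r i)"
    using hr(1) by (simp add: p_def sum_subtractf[symmetric])
  \<comment> \<open>By \<open>exit\<close> the reflected sum loses all its energy within three
    steps.\<close>
  have "N (\<Sum>i<2 ^ m. h i) = Q (\<Sum>i<2 ^ m. h i)" using exit by (simp add: Q_def)
  also have "\<dots> \<le> 2 * Q (\<Sum>i<2 ^ m. p i) + 2 * Q (\<Sum>i<2 ^ m. r i)"
    unfolding eq using P R by (intro Qle) auto
  also have "2 * Q (\<Sum>i<2 ^ m. p i) \<le> 2 * (2 ^ m * (2 * N u))"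
    using P sumQ by (auto intro: order_trans mult_left_mono)
  also have "2 * Q (\<Sum>i<2 ^ m. r i) \<le> 2 * N (\<Sum>i<2 ^ m. r i)"
    using N \<omega> by (simp add: Q_def)
  finally show ?thesis by simp
qed

lemma sum_fun_apply: "(\<Sum>i\<in>A. f i) x = (\<Sum>i\<in>A. f i x)"
  by (induction A rule: infinite_finite_induct) auto

lemma nn2_indicator_le: "B \<in> sets borel \<Longrightarrow> nn2 (indicator B) \<le> emeasure lborel B"
proof -
  assume [measurable]: "B \<in> sets borel"
  have "nn2 (indicator B) \<le> (\<integral>\<^sup>+x. indicator B x \<partial>lborel)"
    unfolding nn2_def by (intro nn_integral_mono) (auto simp: cut_def indicator_def)
  then show ?thesis by simp
qed

lemma L2plus_indicator:
  assumes [measurable]: "B \<in> sets borel" and B: "emeasure lborel B \<le> ennreal c" and "0 \<le> c"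
  shows "indicator B \<in> L2plus" and "l2sq (indicator B) \<le> c"
proof -
  have le: "nn2 (indicator B) \<le> ennreal c"
    using nn2_indicator_le[OF assms(1)] B by (rule order_trans)
  have "(\<lambda>x. indicator {0..} x *\<^sub>R indicator B x :: complex) \<in> borel_measurable borel" by measurable
  then have m: "cut (indicator B) \<in> borel_measurable borel" by (simp add: cut_def)
  show "indicator B \<in> L2plus" by (rule L2plusI[OF m le])
  show "l2sq (indicator B) \<le> c" by (rule l2sq_leI[OF le assms(3)])
qed

section \<open>Failure of similarity\<close>

text \<open>A half-open window of length t always contains a point b - k t; this places events in
  continuous time on the grid of multiples of t.\<close>

lemma nat_multiple_in_window:
  fixes t b :: real
  assumes "0 < t" "3 * t \<le> b"
  shows "\<exists>k::nat. 2 * t \<le> b - real k * t \<and> b - real k * t < 3 * t \<and> 0 < k"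
proof (intro exI conjI)
  let ?k = "nat (\<lfloor>b / t\<rfloor> - 2)"
  have "3 \<le> b / t" using assms by (simp add: field_simps)
  then have f: "3 \<le> \<lfloor>b / t\<rfloor>" by (simp add: le_floor_iff)
  then show "0 < ?k" by simp
  have k: "real ?k = real_of_int \<lfloor>b / t\<rfloor> - 2" using f by (simp add: of_nat_nat)
  have "real ?k * t \<le> (b / t - 2) * t" "(b / t - 3) * t < real ?k * t"
    unfolding k using assms(1) by (intro mult_right_mono mult_strict_right_mono; linarith)+
  then show "2 * t \<le> b - real ?k * t" "b - real ?k * t < 3 * t"
    using assms(1) by (simp_all add: algebra_simps)
qed

definition cut2 :: "hvec \<Rightarrow> hvec" where
  "cut2 u = (cut (fst u), cut (snd u))"

lemma cut_cut [simp]: "cut (cut f) = cut f"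
  by (auto simp: cut_def indicator_def)

lemma L2plus_cut: "f \<in> L2plus \<Longrightarrow> cut f \<in> L2plus"
  by (simp add: L2plus_iff nn2_def)

lemma cut2_Hsp: "u \<in> Hsp \<Longrightarrow> cut2 u \<in> Hsp"
  by (auto simp: Hsp_def cut2_def intro: L2plus_cut)

lemma hnorm_diff_cut2: "hnorm (hdiff (cut2 u) u) = 0"
proof -
  have "hnorm (hdiff (cut2 u) u) = hnorm 0"
    by (rule hnorm_cong) (simp add: hdiff_def cut2_def zero_prod_def)
  then show ?thesis by simp
qed

section \<open>Exact semigroup law on normalized representatives, and the lower bound on similarity
  constants\<close>

context doubling
begin

text \<open>The composition law for \<open>Ta\<close> can fail on the negative axis, because
  \<open>Lsh\<close> drags values there. Cutting turns it into an equality of functions, so iterates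
  can be rewritten.\<close>

definition D :: "real \<Rightarrow> hvec \<Rightarrow> hvec" where
  "D t u = cut2 (Ta J a t u)"

lemma Vop_zeroI: "(\<And>n. x \<in> E t n \<Longrightarrow> f (2 * a n - x - t) = 0) \<Longrightarrow> Vop J a t f x = 0"
  by (cases "\<exists>n. x \<in> E t n") (auto simp: Vop_E Vop_zero)

text \<open>This is L(s)V(t) + V(s)R(t) = V(s + t): a particle seen at x was reflected either during
  the first t units of time, when x + s <= a_n, or during the last s.\<close>

lemma Vop_semigroup:
  assumes "0 \<le> s" "0 \<le> t" "0 \<le> x"
  shows "Vop J a t g (x + s) + Vop J a s (cut (Rsh t g)) x = Vop J a (s + t) g x"
proof (cases "\<exists>n. x \<in> E (s + t) n")
  case True
  then obtain n where n: "x \<in> E (s + t) n" by blast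
  show ?thesis
  proof (cases "x + s \<le> a n")
    case True
    then have xs: "x + s \<in> E t n" using n assms by (auto simp: E_def)
    have "Vop J a s (cut (Rsh t g)) x = 0"
    proof (rule Vop_zeroI)
      fix m assume m: "x \<in> E s m"
      show "cut (Rsh t g) (2 * a m - x - s) = 0"
      proof (rule ccontr)
        assume "cut (Rsh t g) (2 * a m - x - s) \<noteq> 0"
        then have "0 \<le> 2 * a m - x - s - t"
          by (auto simp: cut_def Rsh_def split: if_splits)
        then have "x \<in> E (s + t) m" using m assms by (auto simp: E_def)
        then have "m = n" using n by (rule E_unique)
        then show False using m True by (auto simp: E_def)
      qed
    qed
    then show ?thesis using Vop_E[OF xs] Vop_E[OF n] by (simp add: algebra_simps)
  next
    case False
    then have xs: "x \<in> E s n" using n assms by (auto simp: E_def)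
    have "x + s \<notin> E t m" for m
    proof
      assume m: "x + s \<in> E t m"
      then have "x \<in> E (s + t) m" using assms by (auto simp: E_def)
      then have "m = n" using n by (rule E_unique)
      then show False using m False by (auto simp: E_def)
    qed
    then have "Vop J a t g (x + s) = 0" by (rule Vop_zero)
    moreover have "cut (Rsh t g) (2 * a n - x - s) = g (2 * a n - x - (s + t))"
      using n assms by (simp add: E_def Rsh_def algebra_simps)
    ultimately show ?thesis using Vop_E[OF xs] Vop_E[OF n] by simp
  qed
next
  case False
  have "Vop J a t g (x + s) = 0"
  proof (rule Vop_zero)
    have "x \<in> E (s + t) n" if "x + s \<in> E t n" for n using that assms by (auto simp: E_def)
    then show "x + s \<notin> E t n" for n using False by blast
  qed
  moreover have "Vop J a s (cut (Rsh t g)) x = 0"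
  proof (rule Vop_zeroI)
    fix m assume "x \<in> E s m"
    then have "x \<in> E (s + t) m" if "0 \<le> 2 * a m - x - s - t"
      using that assms by (auto simp: E_def)
    then have "\<not> 0 \<le> 2 * a m - x - s - t" using False by blast
    then show "cut (Rsh t g) (2 * a m - x - s) = 0" by (simp add: cut_def Rsh_def)
  qed
  moreover have "Vop J a (s + t) g x = 0" using False by (intro Vop_zero) auto
  ultimately show ?thesis by simp
qed

lemma D_semigroup:
  assumes "0 \<le> s" "0 \<le> t"
  shows "D s (D t u) = D (s + t) u"
proof -
  have "cut (Lsh s (cut (Lsh t (fst u) + Vop J a t (snd u))) + Vop J a s (cut (Rsh t (snd u)))) x
      = cut (Lsh (s + t) (fst u) + Vop J a (s + t) (snd u)) x" for x
    using Vop_semigroup[OF assms, of x "snd u"] assms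
    by (cases "0 \<le> x") (simp_all add: Lsh_def algebra_simps)
  moreover have "cut (Rsh s (cut (Rsh t (snd u)))) x = cut (Rsh (s + t) (snd u)) x" for x
    using assms by (cases "0 \<le> x") (auto simp: Rsh_def cut_def algebra_simps)
  ultimately show ?thesis by (simp add: D_def Ta_eq cut2_def fun_eq_iff)
qed

text \<open>Only positive iterates are covered: \<open>D 0\<close> cuts, whereas the zeroth power is
  the identity.\<close>

lemma D_funpow:
  assumes "0 \<le> t"
  shows "(D t ^^ Suc k) u = D (real (Suc k) * t) u"
  using assms by (induction k) (simp_all add: D_semigroup algebra_simps)

lemma D_add: "D t (u + v) = D t u + D t v" and D_diff: "D t (u - v) = D t u - D t v"
proof -
  have *: "D t (hlin c u v) = hlin c (D t u) (D t v)" for c u v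
    unfolding D_def Ta_linear by (simp add: hlin_def cut2_def cut_def fun_eq_iff algebra_simps)
  have m: "hlin (-1) u v = v - u" for u v
    by (simp add: hlin_def minus_prod_def fun_eq_iff)
  show "D t (u + v) = D t u + D t v" using *[of 1 u v] by (simp only: hlin_add)
  show "D t (u - v) = D t u - D t v" using *[of "-1" v u] by (simp only: m)
qed

lemma D_Hsp: "u \<in> Hsp \<Longrightarrow> 0 \<le> t \<Longrightarrow> D t u \<in> Hsp"
  unfolding D_def by (intro cut2_Hsp Ta_Hsp)

text \<open>Shortly before time 2 a_n only the copy made at a_n is present: copies from smaller a_m
  have left through 0 since 2 a_m <= a_n < s, and the incoming block has not passed a larger a_m
  since s + 2 t <= 2 a_n <= a_m.\<close>

lemma Vop_indicator:
  assumes n: "n \<in> J" and t: "0 < t" "3 * t \<le> a n" and th: "2 * t \<le> 2 * a n - s" "2 * a n - s < 3 * t"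
  shows "Vop J a s (indicator {0..<2 * t}) = indicator {2 * a n - s - 2 * t<..2 * a n - s}"
proof
  fix x
  show "Vop J a s (indicator {0..<2 * t}) x = indicator {2 * a n - s - 2 * t<..2 * a n - s} x"
  proof (cases "x \<in> E s n")
    case True
    then show ?thesis by (auto simp: Vop_E indicator_def)
  next
    case False
    then have "x \<notin> {2 * a n - s - 2 * t<..2 * a n - s}" using n t th by (auto simp: E_def)
    moreover have "Vop J a s (indicator {0..<2 * t}) x = 0"
    proof (rule Vop_zeroI)
      fix m assume m: "x \<in> E s m"
      then consider "m < n" | "n < m" using False by (metis linorder_neqE)
      then show "indicator {0..<2 * t} (2 * a m - x - s) = 0"
      proof cases
        case 1
        then show ?thesis using gr[of m n] m n t th by (auto simp: E_def)
      next
        case 2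
        then show ?thesis using gr[of n m] m n t th by (auto simp: E_def indicator_def)
      qed
    qed
    ultimately show ?thesis by simp
  qed
qed

text \<open>The orbit of \<open>u = (0, \<chi>\<^bsub>[0, 2t)\<^esub>)\<close> is observed just before the copies reflected at \<open>a n\<close> leave
  through 0. The reflected parts then add up coherently (norm of order \<open>M = 2 ^ m\<close>), while the
  transmitted parts are orthogonal (norm of order \<open>\<surd>M\<close>).\<close>
lemma similarity_bound:
  assumes inv: "inverse_ops S S'"
    and C: "\<And>u. u \<in> Hsp \<Longrightarrow> hnorm (S u) \<le> C * hnorm u"
    and C': "\<And>u. u \<in> Hsp \<Longrightarrow> hnorm (S' u) \<le> C' * hnorm u"
    and contr: "\<And>u. u \<in> Hsp \<Longrightarrow> hnorm (S (Ta J a t (S' u))) \<le> \<kappa> * hnorm u" and \<kappa>: "1 \<le> \<kappa>"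
    and l: "l \<in> J" "l + 2 ^ m \<in> J" and t: "0 < t" "10 * t \<le> a l"
    and short: "\<And>k::nat. real k * t \<le> 2 * a (l + 2 ^ m) \<Longrightarrow> (\<kappa>\<^sup>2) ^ k \<le> 2"
  shows "2 ^ m \<le> 12 * (C * C')\<^sup>2"
proof -
  have S: "bounded_op S" and S': "bounded_op S'" and SS': "\<And>u. u \<in> Hsp \<Longrightarrow> hnorm (hdiff (S' (S u)) u) = 0"
    using inv by (auto simp: inverse_ops_def)
  note SH = bounded_op_Hsp[OF S] bounded_op_Hsp[OF S']
  \<comment> \<open>The equivalent quadratic form in which T(t) has bound \<kappa>^2; the similarity
    enters below only through it.\<close>
  define N where "N u = (hnorm (S u))\<^sup>2" for u
  have Nle: "N u \<le> C\<^sup>2 * (hnorm u)\<^sup>2" if "u \<in> Hsp" for u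
    using power_mono[OF C[OF that], of 2] by (simp add: N_def power_mult_distrib)
  have Nge: "(hnorm u)\<^sup>2 \<le> C'\<^sup>2 * N u" if "u \<in> Hsp" for u
  proof -
    have "hnorm u = hnorm (S' (S u))"
      using that by (intro hnorm_null_diff[OF _ _ SS', symmetric] SH) auto
    also have "\<dots> \<le> C' * hnorm (S u)" by (rule C'[OF SH(1)[OF that]])
    finally show ?thesis using power_mono[of "hnorm u" "C' * hnorm (S u)" 2]
      by (simp add: N_def power_mult_distrib)
  qed
  have para: "N (u + v) + N (u - v) = 2 * N u + 2 * N v" if "u \<in> Hsp" "v \<in> Hsp" for u v
    using hnorm_parallelogram[of "S u" "S v"] that by (simp add: N_def bounded_op_hnorm[OF S that] SH)
  have contrN: "N (D t u) \<le> \<kappa>\<^sup>2 * N u" if u: "u \<in> Hsp" for u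
  proof -
    have T: "bounded_op (Ta J a t)" using t by (intro bounded_op_Ta) simp
    have TH: "Ta J a t w \<in> Hsp" if "w \<in> Hsp" for w using that t by (intro Ta_Hsp) auto
    have S'S: "S' (S u) \<in> Hsp" using u SH by simp
    have "hnorm (hdiff (Ta J a t (S' (S u))) (Ta J a t u)) = 0"
      by (rule bounded_op_null[OF T S'S u SS'[OF u]])
    then have "hnorm (S (Ta J a t (S' (S u)))) = hnorm (S (Ta J a t u))"
      by (intro bounded_op_hnorm(3)[OF S] TH S'S u)
    moreover have "hnorm (S (D t u)) = hnorm (S (Ta J a t u))"
      unfolding D_def by (intro bounded_op_hnorm(3)[OF S] cut2_Hsp TH u hnorm_diff_cut2)
    ultimately have "hnorm (S (D t u)) \<le> \<kappa> * hnorm (S u)" using contr[OF SH(1)[OF u]] by simp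
    from power_mono[OF this, of 2] show ?thesis by (simp add: N_def power_mult_distrib)
  qed
  define M :: nat where "M = 2 ^ m"
  define n where "n i = l + int i" for i
  have nM: "l + 2 ^ m = n M" by (simp add: n_def M_def)
  have nJ: "n i \<in> J" if "i \<le> M" for i
    using J_between[OF l, of "n i"] that unfolding nM by (simp add: n_def)
  have na: "10 * t \<le> a (n i)" "a (n i) \<le> a (l + 2 ^ m)" if "i \<le> M" for i
    using t a_mono[OF l(1) nJ[OF that]] a_mono[OF nJ[OF that] l(2)] that
    unfolding nM by (auto simp: n_def)
  \<comment> \<open>The observation time k_i t is chosen so that the front of the reflected block
    lies in [2 t, 3 t).\<close>
  have "\<exists>k. 2 * t \<le> 2 * a (n i) - real k * t \<and> 2 * a (n i) - real k * t < 3 * t \<and> 0 < k" if "i \<le> M" for i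
    using na[OF that] t by (intro nat_multiple_in_window) auto
  then obtain k :: "nat \<Rightarrow> nat" where k: "2 * t \<le> 2 * a (n i) - real (k i) * t"
    "2 * a (n i) - real (k i) * t < 3 * t" "0 < k i" if "i \<le> M" for i by metis
  \<comment> \<open>Doubling separates the times 2 a_n by at least 2 a_l >= 20 t, which leaves ample
    room for the rounding error of less than t.\<close>
  have kgap: "real (k i) * t + 3 * t \<le> real (k j) * t" if "i < j" "j \<le> M" for i j
    using gr[of "n i" "n j"] nJ[of i] nJ[of j] na[of i] k[of i] k[of j] t that by (simp add: n_def)
  have kgap': "k i + 3 \<le> k j" if "i < j" "j \<le> M" for i j
  proof -
    have "real (k i + 3) * t \<le> real (k j) * t" using kgap[OF that] by (simp add: algebra_simps)
    then have "real (k i + 3) \<le> real (k j)" using t by (rule_tac mult_right_le_imp_le)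
    then show ?thesis by linarith
  qed
  have klt: "(\<kappa>\<^sup>2) ^ k i \<le> 2" if "i \<le> M" for i
    using k[OF that] na[OF that] t by (intro short) linarith

  define u :: hvec where "u = (0, indicator {0..<2 * t})"
  define B where "B i = {2 * a (n i) - real (k i) * t - 2 * t<..2 * a (n i) - real (k i) * t}" for i
  define A where "A i = {real (k i) * t..<real (k i) * t + 2 * t}" for i
  define h :: "nat \<Rightarrow> hvec" where "h i = (cut (indicator (B i)), 0)" for i
  define r :: "nat \<Rightarrow> hvec" where "r i = (0, cut (indicator (A i)))" for i
  have ind: "indicator X \<in> L2plus" "l2sq (indicator X) \<le> 2 * t"
    if "X = {x..<x + 2 * t} \<or> X = {x - 2 * t<..x}" for X x
    using that t by (intro L2plus_indicator[where c = "2 * t"]; auto)+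
  have uH: "u \<in> Hsp" and uN: "(hnorm u)\<^sup>2 \<le> 2 * t"
    using ind[of "{0..<2 * t}" 0] by (auto simp: u_def Hsp_def L2plus_zero hnorm_sq l2sq_eq cut_def)
  have hH: "h i \<in> Hsp" and rH: "r i \<in> Hsp" for i
    using ind(1)[of "B i" "2 * a (n i) - real (k i) * t"] ind(1)[of "A i" "real (k i) * t"]
    by (auto simp: h_def r_def Hsp_def B_def A_def intro!: L2plus_zero L2plus_cut)
  have orbit: "(D t ^^ k i) u = h i + r i" if i: "i < M" for i
  proof -
    obtain k' where k': "k i = Suc k'" using k(3)[of i] i gr0_implies_Suc[of "k i"] by auto
    have "(D t ^^ k i) u = D (real (k i) * t) u"
      unfolding k' using t by (intro D_funpow) simp
    moreover have "Vop J a (real (k i) * t) (indicator {0..<2 * t}) = indicator (B i)"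
      unfolding B_def using i k[of i] na[of i] t nJ[of i] by (intro Vop_indicator) auto
    moreover have "Lsh (real (k i) * t) 0 = 0" by (simp add: Lsh_def fun_eq_iff)
    moreover have "Rsh (real (k i) * t) (indicator {0..<2 * t}) = indicator (A i)"
      by (auto simp: Rsh_def A_def indicator_def fun_eq_iff)
    ultimately show ?thesis
      by (simp add: D_def Ta_eq u_def cut2_def h_def r_def)
  qed
  define H :: fn where "H = (\<Sum>i<M. cut (indicator (B i)))"
  have sumh: "(\<Sum>i<M. h i) = (H, 0)"
    by (simp add: h_def H_def prod_eq_iff fst_sum snd_sum)
  have sumr: "(\<Sum>i<M. r i) = (0, \<Sum>i<M. cut (indicator (A i)))"
    by (simp add: r_def prod_eq_iff fst_sum snd_sum)
  \<comment> \<open>Every block \<open>B i\<close> lies in (0, 3 t), so three steps to the left push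
    all of them through 0.\<close>
  have exit: "N ((D t ^^ 3) (\<Sum>i<M. h i)) = 0"
  proof -
    have "(D t ^^ 3) (\<Sum>i<M. h i) = D (3 * t) (H, 0)"
      using D_funpow[of t 2 "(H, 0)"] t by (simp add: sumh numeral_3_eq_3)
    also have "\<dots> = 0"
    proof -
      have "cut (indicator (B i)) (x + 3 * t) = 0" if "0 \<le> x" "i < M" for x i
        using k(2)[of i] that by (simp add: B_def cut_def)
      then have "H (x + 3 * t) = 0" if "0 \<le> x" for x
        unfolding H_def sum_fun_apply using that by (intro sum.neutral) simp
      then have "cut (Lsh (3 * t) H + Vop J a (3 * t) 0) x = 0" for x
        using Vop_zeroI[of x "3 * t" 0] by (cases "0 \<le> x") (auto simp: Lsh_def)
      moreover have "cut (Rsh (3 * t) 0) x = 0" for x by (simp add: cut_def Rsh_def)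
      ultimately show ?thesis by (simp add: D_def Ta_eq cut2_def zero_prod_def fun_eq_iff)
    qed
    finally have *: "(D t ^^ 3) (\<Sum>i<M. h i) = 0" .
    have "N 0 \<le> C\<^sup>2 * (hnorm 0)\<^sup>2" by (rule Nle[OF Hsp_zero])
    then show ?thesis unfolding * by (simp add: N_def)
  qed
  have main: "N (\<Sum>i<M. h i) \<le> 4 * real M * N u + 2 * N (\<Sum>i<M. r i)"
    unfolding M_def of_nat_power of_nat_numeral
  proof (rule orbit_average_bound[OF Hsp_add Hsp_diff _ para D_Hsp D_add D_diff contrN _ uH])
    show "0 \<le> N x" for x by (simp add: N_def)
    show "0 \<le> t" using t by simp
    show "1 \<le> \<kappa>\<^sup>2" using \<kappa> by simp
    show "k i + 3 \<le> k (Suc i)" if "i < 2 ^ m" for i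
      using kgap'[of i "Suc i"] that by (simp add: M_def)
    show "(\<kappa>\<^sup>2) ^ k i \<le> 2" if "i < 2 ^ m" for i
      using klt[of i] that by (simp add: M_def)
    show "(D t ^^ k i) u = h i + r i" if "i < 2 ^ m" for i
      using orbit[of i] that by (simp add: M_def)
    show "N ((D t ^^ 3) (\<Sum>i<2 ^ m. h i)) = 0" using exit by (simp add: M_def)
  qed (assumption | rule hH rH)+

  \<comment> \<open>By \<open>kgap\<close> the transmitted blocks are disjoint, so their sum is an
    indicator and its squared norm grows only linearly in M.\<close>
  have "(\<Sum>i<M. cut (indicator (A i))) = cut (indicator (\<Union>i<M. A i))"
  proof
    fix x
    have "disjoint_family_on A {..<M}"
      unfolding disjoint_family_on_def A_def using kgap t by (auto simp: neq_iff) force+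
    then have "indicator (\<Union>i<M. A i) x = (\<Sum>i<M. indicator (A i) x :: complex)"
      by (intro indicator_UN_disjoint) auto
    then show "(\<Sum>i<M. cut (indicator (A i))) x = cut (indicator (\<Union>i<M. A i)) x"
      by (simp add: sum_fun_apply cut_def scaleR_sum_right)
  qed
  moreover have "l2sq (indicator (\<Union>i<M. A i)) \<le> real M * (2 * t)"
  proof (rule L2plus_indicator(2))
    show "(\<Union>i<M. A i) \<in> sets borel" by (auto simp: A_def)
    have "emeasure lborel (\<Union>i<M. A i) \<le> (\<Sum>i<M. emeasure lborel (A i))"
      by (rule emeasure_subadditive_finite) (auto simp: A_def)
    also have "\<dots> = ennreal (real M * (2 * t))"
      using t by (simp add: A_def ennreal_mult ennreal_of_nat_eq_real_of_nat)
    finally show "emeasure lborel (\<Union>i<M. A i) \<le> ennreal (real M * (2 * t))" .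
  qed (use t in auto)
  ultimately have "(hnorm (\<Sum>i<M. r i))\<^sup>2 \<le> real M * (2 * t)"
    by (simp add: sumr hnorm_sq l2sq_eq) (simp add: cut_def)
  then have Nr: "N (\<Sum>i<M. r i) \<le> C\<^sup>2 * (real M * (2 * t))"
    using rH by (intro order_trans[OF Nle mult_left_mono] Hsp_sum) auto
  have Nu: "N u \<le> C\<^sup>2 * (2 * t)"
    using uN by (intro order_trans[OF Nle[OF uH] mult_left_mono]) auto

  have HL: "H \<in> L2plus" using Hsp_sum[of "{..<M}" h] hH by (simp add: sumh Hsp_def)
  \<comment> \<open>All blocks \<open>B i\<close> cover [t, 2 t], where H therefore equals
    M.\<close>
  have "(real M)\<^sup>2 * t \<le> l2sq H"
  proof -
    have "ennreal ((real M)\<^sup>2 * t) = ennreal ((real M)\<^sup>2) * emeasure lborel {t..2 * t}"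
      using t by (simp add: ennreal_mult)
    also have "\<dots> = (\<integral>\<^sup>+x. ennreal ((real M)\<^sup>2) * indicator {t..2 * t} x \<partial>lborel)"
      by (rule nn_integral_cmult_indicator[symmetric]) simp
    also have "\<dots> \<le> nn2 H"
      unfolding nn2_def
    proof (rule nn_integral_mono)
      fix x
      have "H x = of_nat M" if x: "t \<le> x" "x \<le> 2 * t"
      proof -
        have "cut (indicator (B i)) x = 1" if "i < M" for i
          using k[of i] that x t by (auto simp: B_def indicator_def)
        then show ?thesis by (simp add: H_def sum_fun_apply)
      qed
      then show "ennreal ((real M)\<^sup>2) * indicator {t..2 * t} x \<le> ennreal ((cmod (cut H x))\<^sup>2)"
        using t by (auto simp: indicator_def)
    qed
    finally show ?thesis by (simp add: nn2_eq[OF HL])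
  qed
  also have "l2sq H = (hnorm (\<Sum>i<M. h i))\<^sup>2"
    by (simp add: sumh hnorm_sq l2sq_eq cut_def)
  also have "\<dots> \<le> C'\<^sup>2 * N (\<Sum>i<M. h i)"
    using hH by (intro Nge Hsp_sum) auto
  \<comment> \<open>The initial vector contributes 8 and the transmitted part 4, which gives the
    constant 12.\<close>
  also have "\<dots> \<le> C'\<^sup>2 * (4 * real M * (C\<^sup>2 * (2 * t)) + 2 * (C\<^sup>2 * (real M * (2 * t))))"
    using Nu Nr by (intro mult_left_mono order_trans[OF main] add_mono) auto
  also have "\<dots> = 12 * (C * C')\<^sup>2 * (real M * t)"
    by (simp add: power_mult_distrib algebra_simps)
  finally have "real M * (real M * t) \<le> 12 * (C * C')\<^sup>2 * (real M * t)"
    by (simp add: power2_eq_square mult.assoc)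
  then have "real M \<le> 12 * (C * C')\<^sup>2"
    by (rule mult_right_le_imp_le) (use t in \<open>simp add: M_def\<close>)
  then show ?thesis by (simp add: M_def)
qed

section \<open>Choice of reflection points and step in the two negative cases\<close>

lemma inverse_ops_bounds:
  assumes "inverse_ops S S'"
  obtains C C' where "\<And>u. u \<in> Hsp \<Longrightarrow> hnorm (S u) \<le> C * hnorm u" "\<And>u. u \<in> Hsp \<Longrightarrow> hnorm (S' u) \<le> C' * hnorm u"
proof -
  have S: "bounded_op S" and S': "bounded_op S'" using assms by (auto simp: inverse_ops_def)
  show thesis using bounded_op_bound[OF S] bounded_op_bound[OF S'] that by blast
qed

text \<open>With \<kappa> = 1 no energy growth accumulates, so the orbit may be followed arbitrarily
  long and t stays fixed while the a_n are taken large.\<close>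

lemma not_similar_to_contraction_Ta:
  assumes JE: "J \<noteq> {..0}" and t: "0 < t"
  shows "\<not> similar_to_contraction (Ta J a t)"
proof
  assume "similar_to_contraction (Ta J a t)"
  then obtain S S' where inv: "inverse_ops S S'"
    and contr: "\<And>u. u \<in> Hsp \<Longrightarrow> hnorm (S (Ta J a t (S' u))) \<le> 1 * hnorm u"
    unfolding similar_to_contraction_def by auto
  obtain C C' where C: "\<And>u. u \<in> Hsp \<Longrightarrow> hnorm (S u) \<le> C * hnorm u"
    "\<And>u. u \<in> Hsp \<Longrightarrow> hnorm (S' u) \<le> C' * hnorm u" using inverse_ops_bounds[OF inv] by blast
  obtain l where l: "l \<in> J" "0 \<le> l" "10 * t < a l" using a_large[OF JE] by blast
  obtain m :: nat where m: "12 * (C * C')\<^sup>2 < 2 ^ m" using real_arch_pow[of 2] by auto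
  have "l + 2 ^ m \<in> J" using l J JE by (auto intro: add_nonneg_nonneg)
  then have "2 ^ m \<le> 12 * (C * C')\<^sup>2"
    using l t by (intro similarity_bound[OF inv C contr]) auto
  with m show False by simp
qed

lemma not_similar_to_quasicontraction_Ta:
  assumes JE: "J \<noteq> {0..}"
  shows "\<not> similar_to_quasicontraction (Ta J a)"
proof
  assume "similar_to_quasicontraction (Ta J a)"
  then obtain S S' w where inv: "inverse_ops S S'"
    and contr: "\<And>t u. 0 \<le> t \<Longrightarrow> u \<in> Hsp \<Longrightarrow> hnorm (S (Ta J a t (S' u))) \<le> exp (w * t) * hnorm u"
    unfolding similar_to_quasicontraction_def by blast
  obtain C C' where C: "\<And>u. u \<in> Hsp \<Longrightarrow> hnorm (S u) \<le> C * hnorm u"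
    "\<And>u. u \<in> Hsp \<Longrightarrow> hnorm (S' u) \<le> C' * hnorm u" using inverse_ops_bounds[OF inv] by blast
  obtain m :: nat where m: "12 * (C * C')\<^sup>2 < 2 ^ m" using real_arch_pow[of 2] by auto
  define c where "c = max w 1"
  \<comment> \<open>All observation times are at most 2 a_p < ln 2 / (2 c), and the energy grows at
    rate 2 c.\<close>
  obtain p where p: "p \<in> J" "p \<le> 0" "a p < ln 2 / (4 * c)"
    using a_small[OF JE, of "ln 2 / (4 * c)"] by (auto simp: c_def)
  define l where "l = p - 2 ^ m"
  have l: "l \<in> J" using p J JE by (auto simp: l_def intro: order_trans[of _ p])
  \<comment> \<open>The step depends on m, so the hypothesis is used for arbitrarily small times and
    not for a single operator.\<close>
  define t where "t = a l / 10"
  have t: "0 < t" using pos[OF l] by (simp add: t_def)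
  have "2 ^ m \<le> 12 * (C * C')\<^sup>2"
  proof (rule similarity_bound[OF inv C _ _ l])
    show "hnorm (S (Ta J a t (S' u))) \<le> exp (c * t) * hnorm u" if "u \<in> Hsp" for u
    proof -
      have "exp (w * t) * hnorm u \<le> exp (c * t) * hnorm u"
        using t by (intro mult_right_mono) (auto simp: c_def)
      then show ?thesis using contr[of t u] that t by linarith
    qed
    show "1 \<le> exp (c * t)" using t by (simp add: c_def)
    show "((exp (c * t))\<^sup>2) ^ k \<le> 2" if "real k * t \<le> 2 * a (l + 2 ^ m)" for k
    proof -
      have "real k * t \<le> ln 2 / (2 * c)" using that p by (simp add: l_def)
      then have "2 * c * (real k * t) \<le> ln 2" by (simp add: c_def field_simps)
      then have "exp (2 * c * (real k * t)) \<le> exp (ln 2)" by (simp only: exp_le_cancel_iff)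
      then show ?thesis by (simp add: exp_of_nat_mult[symmetric] exp_double[symmetric] mult_ac)
    qed
  qed (use p t in \<open>auto simp: l_def t_def\<close>)
  with m show False by simp
qed

end

theorem theorem7p1:
  fixes J :: "int set" and a :: "int \<Rightarrow> real"
  assumes J: "J = UNIV \<or> J = {0..} \<or> J = {..0}"
    and pos: "\<forall>n\<in>J. 0 < a n"
    and incr: "\<forall>n\<in>J. \<forall>m\<in>J. n \<le> m \<longrightarrow> a n \<le> a m"
    and grow_up: "J = UNIV \<or> J = {0..} \<Longrightarrow> \<forall>n\<in>J. 2 * a n \<le> a (n + 1)"
    and grow_down: "J = {..0} \<Longrightarrow> \<forall>n\<in>J. 2 * a (n - 1) \<le> a n"
  shows "(\<forall>t>0. similar_to_contraction (Ta J a t) \<longleftrightarrow> J = {..0})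
         \<and> (similar_to_quasicontraction (Ta J a) \<longleftrightarrow> J = {0..})"
proof -
  interpret doubling J a
  proof
    fix n m assume nm: "n \<in> J" "m \<in> J" "n < m"
    \<comment> \<open>The growth hypothesis for \<open>J = {..0}\<close> is indexed by the upper
      neighbour and is therefore applied at n + 1.\<close>
    have n1: "n + 1 \<in> J" using J nm by auto
    have "2 * a n \<le> a (n + 1)"
    proof (cases "J = {..0}")
      case True
      then show ?thesis using bspec[OF grow_down[OF True] n1] by simp
    next
      case False
      then show ?thesis using grow_up J nm by blast
    qed
    also have "\<dots> \<le> a m" using incr nm n1 by auto
    finally show "2 * a n \<le> a m" .
  qed (use J pos in auto)
  show ?thesis
  proof (intro conjI allI impI)
    show "similar_to_contraction (Ta J a t) \<longleftrightarrow> J = {..0}" if "0 < t" for t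
      using similar_to_contraction_Ta not_similar_to_contraction_Ta that by metis
    show "similar_to_quasicontraction (Ta J a) \<longleftrightarrow> J = {0..}"
      using similar_to_quasicontraction_Ta not_similar_to_quasicontraction_Ta by metis
  qed
qed

end
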